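(* Let $\lambda_0\in\mathbb{C}$ with $\operatorname{Im}(\lambda_0)\neq 0$, let $\alpha>0$, and let $A\in\mathbb{C}$ be non-zero. For a doubly infinite sequence $\{f_k\}_{k\in\mathbb{Z}}$ of functions $f_k:\mathbb{R}\to\mathbb{C}$ consider the conditions (1) for all $k\in\mathbb{Z}$: $\left(\frac{d}{dx}-i\lambda_0+\alpha\right)f_k=A f_{k+1}$ if $\operatorname{Im}(\lambda_0)>0$, and $\left(\frac{d}{dx}-i\lambda_0-\alpha\right)f_k=A f_{k+1}$ if $\operatorname{Im}(\lambda_0)<0$; (2) there is a constant $M>0$ such that $|f_k(x)|\le M e^{|\operatorname{Im}(\lambda_0)|\,|x|}$ for all $x\in\mathbb{R}$ and all $k\in\mathbb{Z}$. Then the following hold. (a) If $|A|=|\alpha|$, then every sequence $\{f_k\}_{k\in\mathbb{Z}}$ satisfying (1) and (2) satisfies $\frac{d}{dx}f_0=i\lambda_0 f_0$, i.e. $f_0(x)=c\,e^{i\lambda_0 x}$ for some constant $c\in\mathbb{C}$. (b) If $|A|<|\alpha|$, then every sequence $\{f_k\}_{k\in\mathbb{Z}}$ satisfying (1) and (2) satisfies $f_k=0$ for all $k\in\mathbb{Z}$. (c) If $|A|>|\alpha|$, then there exists a sequence $\{f_k\}_{k\in\mathbb{Z}}$ satisfying (1) and (2) such that $f_0$ is not an eigenfunction of $\frac{d}{dx}$ (i.e. there is no $\mu\in\mathbb{C}$ with $\frac{d}{dx}f_0=\mu f_0$).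
   Context: Functions are (Lebesgue) measurable, the action of $\frac{d}{dx}$ on them is understood in the sense of distributions on $\mathbb{R}$, and equalities of functions are understood accordingly (almost everywhere). *)

theory Defs
  imports "HOL-Analysis.Analysis"
begin

text \<open>Test functions: infinitely differentiable with compact support, \<open>\<real> \<rightarrow> \<complex>\<close>.\<close>

definition test_function :: "(real \<Rightarrow> complex) \<Rightarrow> bool" where
  "test_function \<phi> \<longleftrightarrow>
     (\<forall>n x. ((\<lambda>g y. vector_derivative g (at y)) ^^ n) \<phi> differentiable (at x)) \<and>
     compact (closure {x. \<phi> x \<noteq> 0})"

text \<open>
  Distributions on \<open>\<real>\<close> are represented by functionals that matter only on test functions
  (hence the equality \<open>dist_eq\<close>). The representation \<open>regular_dist f\<close> is meaningful
  for locally integrable \<open>f\<close>; wherever it is used below, \<open>f\<close> is Lebesgue measurable and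
  locally bounded because of \<open>admissible\<close>.
\<close>

type_synonym dist = "(real \<Rightarrow> complex) \<Rightarrow> complex"

definition regular_dist :: "(real \<Rightarrow> complex) \<Rightarrow> dist" where
  "regular_dist f = (\<lambda>\<phi>. LINT x|lebesgue. f x * \<phi> x)"

definition dist_deriv :: "dist \<Rightarrow> dist" where
  "dist_deriv T = (\<lambda>\<phi>. - T (\<lambda>x. vector_derivative \<phi> (at x)))"

definition dist_eq :: "dist \<Rightarrow> dist \<Rightarrow> bool" where
  "dist_eq S T \<longleftrightarrow> (\<forall>\<phi>. test_function \<phi> \<longrightarrow> S \<phi> = T \<phi>)"

text \<open>\<open>(d/dx + c) f = g\<close> in the sense of distributions.\<close>

definition weak_ode :: "complex \<Rightarrow> (real \<Rightarrow> complex) \<Rightarrow> (real \<Rightarrow> complex) \<Rightarrow> bool" where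
  "weak_ode c f g \<longleftrightarrow>
     dist_eq (\<lambda>\<phi>. dist_deriv (regular_dist f) \<phi> + c * regular_dist f \<phi>) (regular_dist g)"

text \<open>\<open>d/dx f = \<mu> f\<close> in the sense of distributions; \<open>f = 0\<close> is not excluded.\<close>

definition deriv_eq_mult :: "(real \<Rightarrow> complex) \<Rightarrow> complex \<Rightarrow> bool" where
  "deriv_eq_mult f \<mu> \<longleftrightarrow>
     dist_eq (dist_deriv (regular_dist f)) (regular_dist (\<lambda>x. \<mu> * f x))"

definition deriv_chain :: "complex \<Rightarrow> real \<Rightarrow> complex \<Rightarrow> (int \<Rightarrow> real \<Rightarrow> complex) \<Rightarrow> bool" where
  "deriv_chain lam\<^sub>0 \<alpha> A f \<longleftrightarrow>
     (\<forall>k. (Im lam\<^sub>0 > 0 \<longrightarrow> weak_ode (- \<i> * lam\<^sub>0 + of_real \<alpha>) (f k) (\<lambda>x. A * f (k + 1) x)) \<and>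
          (Im lam\<^sub>0 < 0 \<longrightarrow> weak_ode (- \<i> * lam\<^sub>0 - of_real \<alpha>) (f k) (\<lambda>x. A * f (k + 1) x)))"

definition exp_bounded :: "complex \<Rightarrow> (int \<Rightarrow> real \<Rightarrow> complex) \<Rightarrow> bool" where
  "exp_bounded lam\<^sub>0 f \<longleftrightarrow>
     (\<exists>M>0. \<forall>k x. cmod (f k x) \<le> M * exp (\<bar>Im lam\<^sub>0\<bar> * \<bar>x\<bar>))"

definition admissible :: "complex \<Rightarrow> real \<Rightarrow> complex \<Rightarrow> (int \<Rightarrow> real \<Rightarrow> complex) \<Rightarrow> bool" where
  "admissible lam\<^sub>0 \<alpha> A f \<longleftrightarrow>
     (\<forall>k. f k \<in> borel_measurable lebesgue) \<and> deriv_chain lam\<^sub>0 \<alpha> A f \<and> exp_bounded lam\<^sub>0 f"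

end

theory Submission
  imports Defs
begin

text \<open>
  Write \<open>c = - \<i> \<lambda>\<^sub>0 \<plusminus> \<alpha>\<close>, with the sign \<open>\<sigma>\<close> of \<open>Im \<lambda>\<^sub>0\<close> in front of \<open>\<alpha>\<close>, so that the chain
  reads \<open>f\<^sub>k' + c f\<^sub>k = A f\<^sub>k\<^sub>+\<^sub>1\<close>. The idea is to replace the weak equations by classical ones
  without losing anything: for a fixed test function \<open>\<psi>\<close>, the functions
  \<open>F\<^sub>k(x) = \<integral> f\<^sub>k(y) \<psi>(y - x) dy\<close> are differentiable, satisfy the same chain and the same
  growth bound (with another constant), and \<open>F\<^sub>k(0)\<close> is exactly the value of the distribution
  \<open>f\<^sub>k\<close> at \<open>\<psi>\<close>. A statement about \<open>F\<^sub>0(0)\<close> and \<open>F\<^sub>1(0)\<close> for every \<open>\<psi>\<close> is therefore a statement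
  about the distributions \<open>f\<^sub>0\<close> and \<open>f\<^sub>1\<close>.

  The choice of sign makes one half-line favourable. There
  \<open>w\<^sub>k(t) = exp (- c \<sigma> t) F\<^sub>k(- \<sigma> t)\<close> for \<open>t \<ge> 0\<close> satisfies \<open>w\<^sub>k' = - B w\<^sub>k\<^sub>+\<^sub>1\<close> with
  \<open>B = \<sigma> A\<close>, and the growth of \<open>F\<^sub>k\<close> is absorbed by the factor up to
  \<open>|w\<^sub>k(t)| \<le> M exp (- \<alpha> t)\<close>, uniformly in \<open>k\<close> (\<open>admissible_half_line_chain\<close>). Only this
  half-line is used.

  If \<open>|A| < \<alpha>\<close>, integrating \<open>w\<^sub>k' = - B w\<^sub>k\<^sub>+\<^sub>1\<close> from infinity improves the constant \<open>M\<close> by the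
  factor \<open>|A| / \<alpha>\<close>; iterating gives \<open>w\<^sub>0(0) = 0\<close> (\<open>subcritical_chain_zero\<close>). Hence
  \<open>\<integral> f\<^sub>k \<psi> = 0\<close> for all \<open>\<psi>\<close>.

  If \<open>|A| = \<alpha>\<close>, iterated integration represents \<open>w\<^sub>0(0)\<close> as the integral of \<open>w\<^sub>n\<close> against
  \<open>B^n t^(n-1) / (n-1)!\<close>. As \<open>w\<^sub>n exp (\<alpha> t)\<close> is bounded uniformly in \<open>n\<close>, this is the integral of a bounded
  function against the Gamma density \<open>\<alpha>^n t^(n-1) exp (- \<alpha> t) / (n-1)!\<close>, and \<open>B w\<^sub>1(0) - \<alpha> w\<^sub>0(0)\<close> is the
  integral of the same function against the derivative of that density. The total variation of the density is
  twice its maximum, which is a constant multiple of \<open>m^m exp (- m) / m!\<close> with \<open>m = n - 1\<close> and tends to \<open>0\<close>.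
  So \<open>B w\<^sub>1(0) = \<alpha> w\<^sub>0(0)\<close> (\<open>critical_chain_eigen\<close>), that is, \<open>f\<^sub>0' = \<i> \<lambda>\<^sub>0 f\<^sub>0\<close> weakly. The explicit
  form of \<open>f\<^sub>0\<close> then follows because a weakly constant function is constant
  (\<open>weak_deriv_zero_imp_AE_const\<close>).

  If \<open>|A| > \<alpha>\<close>, the numbers \<open>\<i> \<lambda>\<^sub>0 \<plusminus> \<i> s + c\<close> with \<open>s = sqrt (|A|\<^sup>2 - \<alpha>\<^sup>2)\<close> have modulus \<open>|A|\<close>,
  so two different exponentials of the same growth generate chains with unimodular
  coefficients, and their sum is not an eigenfunction (\<open>supercritical_admissible_noneigen\<close>).
\<close>

section \<open>The maximum of the Poisson weights\<close>

text \<open>At \<open>x = 1 / n\<close> the bound reads \<open>(4 n + 1) ln (1 + 1/n) \<le> 4\<close>, which is the induction step of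
  \<open>poisson_mode_bound\<close>. The difference of the two sides vanishes at \<open>0\<close> and has a derivative with the
  sign of \<open>x (8 - x)\<close>.\<close>

lemma ln_one_plus_le:
  fixes x :: real assumes "0 \<le> x" "x \<le> 1"
  shows "ln (1 + x) \<le> 4 * x / (4 + x)"
proof -
  have "(\<lambda>x. 4 * x / (4 + x) - ln (1 + x)) 0 \<le> (\<lambda>x. 4 * x / (4 + x) - ln (1 + x)) x"
  proof (rule DERIV_nonneg_imp_nondecreasing[OF assms(1)])
    fix y :: real assume y: "0 \<le> y" "y \<le> x"
    have "((\<lambda>x. 4 * x / (4 + x) - ln (1 + x)) has_real_derivative
        (16 / (4 + y)^2 - 1 / (1 + y))) (at y)"
      using y by (auto intro!: derivative_eq_intros simp: field_simps power2_eq_square)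
    moreover have "16 / (4 + y)^2 - 1 / (1 + y) \<ge> 0"
    proof -
      have "(4 + y)^2 \<le> 16 * (1 + y)"
      proof -
        have "y * (8 - y) \<ge> 0" using y assms by (intro mult_nonneg_nonneg) auto
        thus ?thesis by (simp add: power2_eq_square algebra_simps)
      qed
      thus ?thesis using y by (simp add: field_simps)
    qed
    ultimately show "\<exists>z. ((\<lambda>x. 4 * x / (4 + x) - ln (1 + x)) has_real_derivative z) (at y) \<and> 0 \<le> z"
      by blast
  qed
  thus ?thesis by simp
qed

lemma fact_plus_fact_mult_nonzero: "fact n + fact n * real n \<noteq> 0"
  using fact_nonzero[of "Suc n", where 'a = real] by (simp add: algebra_simps)

text \<open>The left-hand side is the largest weight of the Poisson distribution with mean \<open>n\<close>; by
  Stirling's formula it is of order \<open>1 / sqrt n\<close>, but any negative power of \<open>n\<close> is enough here. The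
  ratio of the weights for \<open>n + 1\<close> and \<open>n\<close> is \<open>r = (1 + 1/n)^n / e\<close>, about \<open>1 - 1 / (2 n)\<close>; the
  fourth power leaves enough room for \<open>r^4 \<le> n / (n + 1)\<close>, and the induction telescopes.\<close>

lemma poisson_mode_bound:
  assumes "n \<ge> 1"
  shows "(real n ^ n * exp (- real n) / fact n) ^ 4 \<le> 1 / real n"
  using assms
proof (induction n rule: nat_induct_at_least)
  case base
  have "exp (-1::real) \<le> 1" by simp
  hence "exp (-1::real) ^ 4 \<le> 1" by (rule power_le_one[rotated]) simp
  thus ?case by simp
next
  case (Suc n)
  define p where "p = real n ^ n * exp (- real n) / fact n"
  define r where "r = (1 + 1 / real n) ^ n * exp (-1)"
  have n: "real n > 0" using Suc by simp
  have "(1 + 1 / real n) ^ n * real n ^ n = (real n + 1) ^ n"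
    using n by (simp add: field_simps flip: power_mult_distrib)
  hence eq: "real (Suc n) ^ Suc n * exp (- real (Suc n)) / fact (Suc n) = p * r"
    using n exp_add[of "- real n" "-1"] fact_plus_fact_mult_nonzero[of n] unfolding p_def r_def
    by (simp add: field_simps)
  have "r ^ 4 \<le> n / (n + 1)"
  proof -
    have "r = exp (n * ln (1 + 1 / n) - 1)"
      unfolding r_def using n by (simp add: exp_diff exp_minus field_simps exp_of_nat_mult add_pos_pos)
    hence "r ^ 4 = exp (4 * (n * ln (1 + 1 / n) - 1))"
      by (simp flip: exp_of_nat_mult)
    also have "\<dots> \<le> exp (- ln (1 + 1 / n))"
    proof -
      have "ln (1 + 1 / n) \<le> 4 * (1 / n) / (4 + 1 / n)"
        using Suc by (intro ln_one_plus_le) auto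
      also have "\<dots> = 4 / (4 * n + 1)" using n by (simp add: field_simps)
      finally have "ln (1 + 1 / n) * (4 * n + 1) \<le> 4" using n by (simp add: field_simps)
      thus ?thesis by (simp add: algebra_simps)
    qed
    also have "\<dots> = n / (n + 1)" using n by (simp add: exp_minus field_simps add_pos_pos)
    finally show ?thesis .
  qed
  moreover have "p ^ 4 \<le> 1 / n" using Suc.IH unfolding p_def .
  ultimately have "p ^ 4 * r ^ 4 \<le> (1 / n) * (n / (n + 1))"
    by (intro mult_mono) auto
  thus ?case unfolding eq using n by (simp add: power_mult_distrib field_simps)
qed

lemma poisson_mode_tendsto_0:
  "(\<lambda>n. real n ^ n * exp (- real n) / fact n) \<longlonglongrightarrow> 0"
proof -
  have "(\<lambda>n. (real n ^ n * exp (- real n) / fact n) ^ 4) \<longlonglongrightarrow> 0"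
  proof (rule tendsto_sandwich[OF _ _ tendsto_const lim_1_over_n])
    show "\<forall>\<^sub>F n in sequentially. 0 \<le> (real n ^ n * exp (- real n) / fact n) ^ 4" by simp
    show "\<forall>\<^sub>F n in sequentially. (real n ^ n * exp (- real n) / fact n) ^ 4 \<le> 1 / real n"
      using eventually_ge_at_top[of 1] by eventually_elim (rule poisson_mode_bound)
  qed
  hence "(\<lambda>n. root 4 ((real n ^ n * exp (- real n) / fact n) ^ 4)) \<longlonglongrightarrow> root 4 0"
    by (rule tendsto_real_root)
  thus ?thesis by (simp add: real_root_power_cancel)
qed

section \<open>Decaying chains on a half-line\<close>

text \<open>The Taylor polynomial of \<open>w\<^sub>0\<close> at \<open>t\<close>, evaluated at \<open>0\<close>: if \<open>w\<^sub>k' = - B w\<^sub>k\<^sub>+\<^sub>1\<close>, then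
  \<open>B ^ j * w j t\<close> is \<open>(- 1) ^ j\<close> times the \<open>j\<close>-th derivative of \<open>w\<^sub>0\<close>. Its value at \<open>t = 0\<close> is
  \<open>w 0 0\<close>.\<close>

definition taylor_sum :: "complex \<Rightarrow> (nat \<Rightarrow> real \<Rightarrow> complex) \<Rightarrow> nat \<Rightarrow> real \<Rightarrow> complex" where
  "taylor_sum B w n t = (\<Sum>j\<le>n. of_real (t ^ j / fact j) * B ^ j * w j t)"

lemma power_div_fact_deriv:
  "((\<lambda>t::real. t ^ Suc n / fact (Suc n)) has_real_derivative t ^ n / fact n) (at t)"
proof -
  have "((\<lambda>t. t ^ Suc n / fact (Suc n)) has_real_derivative
      real (Suc n) * t ^ n / fact (Suc n)) (at t)"
    using DERIV_cdivide[OF DERIV_pow[of "Suc n" t UNIV], of "fact (Suc n)"] by simp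
  also have "real (Suc n) * t ^ n / fact (Suc n) = t ^ n / fact n"
    by (simp add: divide_simps)
  finally show ?thesis .
qed

text \<open>The derivatives of neighbouring terms cancel, and only the Gamma density of the last one is
  left. This replaces \<open>n\<close>-fold integration of the chain.\<close>

lemma taylor_sum_deriv:
  assumes "\<And>k t. (w k has_vector_derivative - B * w (Suc k) t) (at t)"
  shows "(taylor_sum B w n has_vector_derivative
           - (of_real (t ^ n / fact n) * B ^ Suc n * w (Suc n) t)) (at t)"
proof (induction n)
  case 0
  show ?case using assms[of 0 t] by (simp add: taylor_sum_def[abs_def])
next
  case (Suc n)
  from has_vector_derivative_mult[OF has_vector_derivative_mult_left[OF
      has_vector_derivative_of_real[OF power_div_fact_deriv]] assms]
  have "((\<lambda>t. of_real (t ^ Suc n / fact (Suc n)) * B ^ Suc n * w (Suc n) t) has_vector_derivative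
      of_real (t ^ Suc n / fact (Suc n)) * B ^ Suc n * (- B * w (Suc (Suc n)) t)
      + of_real (t ^ n / fact n) * B ^ Suc n * w (Suc n) t) (at t)" .
  from has_vector_derivative_add[OF Suc this]
  show ?case by (simp add: taylor_sum_def[abs_def] algebra_simps)
qed


text \<open>Exponential decay beats the powers of \<open>t\<close>, so expanding from infinity leaves no boundary
  terms.\<close>

lemma taylor_sum_tendsto_0:
  assumes "\<alpha> > 0" and bnd: "\<And>k t. t \<ge> 0 \<Longrightarrow> cmod (w k t) \<le> M * exp (- \<alpha> * t)"
  shows "(taylor_sum B w n \<longlongrightarrow> 0) at_top"
proof -
  have "((\<lambda>t. of_real (t ^ j / fact j) * B ^ j * w j t) \<longlongrightarrow> 0) at_top" for j
  proof (rule Lim_null_comparison)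
    show "\<forall>\<^sub>F t in at_top. norm (of_real (t ^ j / fact j) * B ^ j * w j t)
        \<le> (M * cmod B ^ j / fact j / \<alpha> ^ j) * ((\<alpha> * t) ^ j / exp (\<alpha> * t))"
      using eventually_ge_at_top[of 0]
    proof eventually_elim
      case (elim t)
      have "norm (of_real (t ^ j / fact j) * B ^ j * w j t)
          = t ^ j / fact j * cmod B ^ j * cmod (w j t)"
        using elim by (simp add: norm_mult norm_power norm_divide)
      also have "\<dots> \<le> t ^ j / fact j * cmod B ^ j * (M * exp (- \<alpha> * t))"
        using elim by (intro mult_left_mono bnd) auto
      also have "\<dots> = (M * cmod B ^ j / fact j / \<alpha> ^ j) * ((\<alpha> * t) ^ j / exp (\<alpha> * t))"
        using assms(1) by (simp add: exp_minus field_simps power_mult_distrib)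
      finally show ?case .
    qed
    have "filterlim (\<lambda>t. \<alpha> * t) at_top at_top"
      using assms(1) by (simp add: filterlim_tendsto_pos_mult_at_top[OF tendsto_const] filterlim_ident)
    from filterlim_compose[OF tendsto_power_div_exp_0 this]
    have "((\<lambda>t. (\<alpha> * t) ^ j / exp (\<alpha> * t)) \<longlongrightarrow> 0) at_top" .
    thus "((\<lambda>t. (M * cmod B ^ j / fact j / \<alpha> ^ j) * ((\<alpha> * t) ^ j / exp (\<alpha> * t))) \<longlongrightarrow> 0) at_top"
      by (rule tendsto_mult_right_zero)
  qed
  thus ?thesis unfolding taylor_sum_def[abs_def] by (rule tendsto_null_sum)
qed

text \<open>Mean value inequality with a majorant: estimates for integrals of derivatives can thus be
  obtained without integrals.\<close>

lemma norm_diff_le_majorant: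
  fixes f :: "real \<Rightarrow> complex" and \<phi> :: "real \<Rightarrow> real"
  assumes "a \<le> b"
    and f: "\<And>t. (f has_vector_derivative f' t) (at t)"
    and \<phi>: "\<And>t. (\<phi> has_vector_derivative \<phi>' t) (at t)"
    and bnd: "\<And>t. a < t \<Longrightarrow> t < b \<Longrightarrow> norm (f' t) \<le> \<phi>' t"
  shows "norm (f b - f a) \<le> \<phi> b - \<phi> a"
proof (cases "a = b")
  case False
  have "continuous_on {a..b} f" "continuous_on {a..b} \<phi>"
    using f \<phi> by (meson continuous_at_imp_continuous_on has_vector_derivative_continuous)+
  with False assms show ?thesis by (intro differentiable_bound_general[of a b f \<phi> f' \<phi>']) auto
qed simp

text \<open>Let \<open>\<Psi>\<close> be \<open>B\<close> times the Taylor sum of the shifted chain minus \<open>\<alpha>\<close> times the Taylor sum of the chain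
  with one more term. Then \<open>\<Psi> 0 = B w\<^sub>1(0) - \<alpha> w\<^sub>0(0)\<close>, \<open>\<Psi>\<close> vanishes at infinity, and
  \<open>\<Psi>'\<close> contains both Gamma densities with the same factor \<open>w (n + 2)\<close>, so the decay of \<open>w\<close> gives
  \<open>|\<Psi>'| \<le> |q'|\<close> for \<open>q t = M \<alpha>^(n+2) t^(n+1) exp (- \<alpha> t) / (n+1)!\<close>. The function \<open>q\<close> increases
  up to \<open>(n+1) / \<alpha>\<close> and decreases from there on; hence \<open>|\<Psi> 0|\<close> is at most twice its maximum, which tends
  to \<open>0\<close> as \<open>n\<close> grows.\<close>

lemma critical_chain_eigen:
  assumes "\<alpha> > 0" "cmod B = \<alpha>"
    and der: "\<And>k t. (w k has_vector_derivative - B * w (Suc k) t) (at t)"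
    and bnd: "\<And>k t. t \<ge> 0 \<Longrightarrow> cmod (w k t) \<le> M * exp (- \<alpha> * t)"
  shows "B * w 1 0 = \<alpha> * w 0 0"
proof -
  have M: "M \<ge> 0" using bnd[of 0 0] norm_ge_zero[of "w 0 0"] by (simp del: norm_ge_zero)
  have bound: "cmod (B * w 1 0 - \<alpha> * w 0 0)
      \<le> 2 * M * \<alpha> * (real (Suc n) ^ Suc n * exp (- real (Suc n)) / fact (Suc n))" for n
  proof -
    define \<Psi> where "\<Psi> t = B * taylor_sum B (\<lambda>k. w (Suc k)) n t - \<alpha> * taylor_sum B w (Suc n) t" for t
    define \<Psi>' where "\<Psi>' t = of_real (\<alpha> * (t ^ Suc n / fact (Suc n)) - t ^ n / fact n)
        * (B ^ Suc (Suc n) * w (Suc (Suc n)) t)" for t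
    define q where "q t = M * \<alpha> ^ Suc (Suc n) * (t ^ Suc n / fact (Suc n) * exp (- \<alpha> * t))" for t
    define q' where "q' t = M * \<alpha> ^ Suc (Suc n) *
        ((t ^ n / fact n - \<alpha> * (t ^ Suc n / fact (Suc n))) * exp (- \<alpha> * t))" for t
    have \<Psi>_deriv: "(\<Psi> has_vector_derivative \<Psi>' t) (at t)" for t
      using has_vector_derivative_diff[OF
          has_vector_derivative_mult_right[OF taylor_sum_deriv[of "\<lambda>k. w (Suc k)" B n t], of B]
          has_vector_derivative_mult_right[OF taylor_sum_deriv[of w B "Suc n" t], of \<alpha>], OF der der]
      unfolding \<Psi>_def[abs_def] \<Psi>'_def by (simp add: algebra_simps)
    have q_deriv: "(q has_vector_derivative q' t) (at t)" for t
    proof -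
      have "((\<lambda>t. exp (- \<alpha> * t)) has_vector_derivative - \<alpha> * exp (- \<alpha> * t)) (at t)"
        by (auto intro!: derivative_eq_intros simp flip: has_real_derivative_iff_has_vector_derivative)
      from has_vector_derivative_mult_right[OF has_vector_derivative_mult[OF
          power_div_fact_deriv[unfolded has_real_derivative_iff_has_vector_derivative, of n] this],
          of "M * \<alpha> ^ Suc (Suc n)"]
      show ?thesis unfolding q_def[abs_def] q'_def by (simp add: algebra_simps del: fact_Suc)
    qed
    have major: "norm (\<Psi>' t) \<le> \<bar>q' t\<bar>" if "t \<ge> 0" for t
    proof -
      have "norm (\<Psi>' t) = \<bar>\<alpha> * (t ^ Suc n / fact (Suc n)) - t ^ n / fact n\<bar>
          * (\<alpha> ^ Suc (Suc n) * cmod (w (Suc (Suc n)) t))"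
        unfolding \<Psi>'_def norm_mult norm_of_real norm_power assms(2) ..
      also have "\<dots> \<le> \<bar>\<alpha> * (t ^ Suc n / fact (Suc n)) - t ^ n / fact n\<bar>
          * (\<alpha> ^ Suc (Suc n) * (M * exp (- \<alpha> * t)))"
        using that assms(1) by (intro mult_left_mono bnd) auto
      also have "\<dots> = \<bar>q' t\<bar>"
        using M assms(1) by (simp add: q'_def abs_mult abs_minus_commute)
      finally show ?thesis .
    qed
    \<comment> \<open>The point where \<open>q\<close> attains its maximum.\<close>
    define a where "a = real (Suc n) / \<alpha>"
    have a: "a > 0" using assms(1) by (simp add: a_def)
    have q'_eq: "q' t = M * \<alpha> ^ Suc (Suc n) * (t ^ n / fact (Suc n)) * exp (- \<alpha> * t)
        * (real (Suc n) - \<alpha> * t)" for t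
    proof -
      have "t ^ n / fact n = t ^ n / fact (Suc n) * real (Suc n)" by (simp add: divide_simps)
      thus ?thesis unfolding q'_def
        by (simp add: algebra_simps add_divide_distrib diff_divide_distrib del: fact_Suc of_nat_Suc)
    qed
    have up: "q' t \<ge> 0" if "0 < t" "t < a" for t
      unfolding q'_eq using that M assms(1)
      by (intro mult_nonneg_nonneg) (auto simp: a_def field_simps)
    have down: "q' t \<le> 0" if "a < t" for t
    proof -
      have "t > 0" using that a by linarith
      thus ?thesis unfolding q'_eq using that M assms(1)
        by (intro mult_nonneg_nonpos mult_nonneg_nonneg) (auto simp: a_def field_simps)
    qed
    have "norm (\<Psi> a - \<Psi> 0) \<le> q a - q 0"
    proof (rule norm_diff_le_majorant[OF _ \<Psi>_deriv q_deriv])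
      show "norm (\<Psi>' t) \<le> q' t" if "0 < t" "t < a" for t
        using major[of t] up[of t] that by simp
    qed (use a in simp)
    also have "q 0 = 0" by (simp add: q_def)
    finally have left: "norm (\<Psi> a - \<Psi> 0) \<le> q a" by simp
    have right: "norm (\<Psi> T - \<Psi> a) \<le> q a" if "T \<ge> a" for T
    proof -
      have "norm (\<Psi> T - \<Psi> a) \<le> - q T - - q a"
      proof (rule norm_diff_le_majorant[OF that \<Psi>_deriv has_vector_derivative_minus[OF q_deriv]])
        show "norm (\<Psi>' t) \<le> - q' t" if "a < t" "t < T" for t
          using major[of t] down[of t] that a by simp
      qed
      moreover have "q T \<ge> 0" using that a M assms(1) by (simp add: q_def)
      ultimately show ?thesis by simp
    qed
    have "norm (\<Psi> 0) \<le> 2 * q a + norm (\<Psi> T)" if "T \<ge> a" for T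
      using left right[OF that] norm_triangle_ineq4[of "\<Psi> T" "\<Psi> T - \<Psi> 0"]
        norm_triangle_ineq[of "\<Psi> T - \<Psi> a" "\<Psi> a - \<Psi> 0"] by simp
    hence "\<forall>\<^sub>F T in at_top. norm (\<Psi> 0) \<le> 2 * q a + norm (\<Psi> T)"
      using eventually_at_top_linorder by blast
    moreover have "((\<lambda>T. 2 * q a + norm (\<Psi> T)) \<longlongrightarrow> 2 * q a + norm (B * 0 - of_real \<alpha> * 0)) at_top"
    proof -
      have "(taylor_sum B w (Suc n) \<longlongrightarrow> 0) at_top"
        "(taylor_sum B (\<lambda>k. w (Suc k)) n \<longlongrightarrow> 0) at_top"
        using bnd by (auto intro!: taylor_sum_tendsto_0[OF assms(1), of _ M])
      thus ?thesis unfolding \<Psi>_def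
        by (intro tendsto_add tendsto_const tendsto_norm tendsto_diff tendsto_mult)
    qed
    ultimately have "norm (\<Psi> 0) \<le> 2 * q a"
      by (intro tendsto_lowerbound[of _ _ at_top "norm (\<Psi> 0)"]) auto
    moreover have "\<Psi> 0 = B * w 1 0 - \<alpha> * w 0 0"
      by (simp add: \<Psi>_def taylor_sum_def power_0_left if_distrib[where f = "\<lambda>x. x / _"]
          if_distrib[where f = of_real] if_distrib[where f = "\<lambda>x. x * _"] cong: if_cong)
    moreover have "q a = M * \<alpha> * (real (Suc n) ^ Suc n * exp (- real (Suc n)) / fact (Suc n))"
      using assms(1) unfolding q_def a_def by (simp add: power_divide field_simps del: of_nat_Suc fact_Suc)
    ultimately show ?thesis by simp
  qed
  have "(\<lambda>n. 2 * M * \<alpha> * (real (Suc n) ^ Suc n * exp (- real (Suc n)) / fact (Suc n)))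
      \<longlonglongrightarrow> 2 * M * \<alpha> * 0"
    by (intro tendsto_mult_left LIMSEQ_Suc poisson_mode_tendsto_0)
  hence "cmod (B * w 1 0 - \<alpha> * w 0 0) \<le> 2 * M * \<alpha> * 0"
    using bound by (intro LIMSEQ_le_const) auto
  thus ?thesis by simp
qed

text \<open>A bound \<open>K exp (- \<alpha> t)\<close> on the whole chain gives \<open>|w\<^sub>k'| \<le> K |B| exp (- \<alpha> t)\<close>; integrating from
  infinity, where \<open>w\<^sub>k\<close> vanishes, improves \<open>K\<close> to \<open>K |B| / \<alpha>\<close>.\<close>

lemma subcritical_chain_zero:
  assumes "\<alpha> > 0" "cmod B < \<alpha>"
    and der: "\<And>k t. (w k has_vector_derivative - B * w (Suc k) t) (at t)"
    and bnd: "\<And>k t. t \<ge> 0 \<Longrightarrow> cmod (w k t) \<le> M * exp (- \<alpha> * t)"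
  shows "w 0 0 = 0"
proof -
  have M: "M \<ge> 0" using bnd[of 0 0] norm_ge_zero[of "w 0 0"] by (simp del: norm_ge_zero)
  define r where "r = cmod B / \<alpha>"
  have r: "0 \<le> r" "r < 1" using assms by (auto simp: r_def)
  have bnd_n: "cmod (w k t) \<le> M * r ^ n * exp (- \<alpha> * t)" if "t \<ge> 0" for n k t
    using that
  proof (induction n arbitrary: k t)
    case (Suc n)
    define E where "E = (\<lambda>s. - (M * r ^ Suc n) * exp (- \<alpha> * s))"
    have E_deriv: "(E has_vector_derivative M * r ^ n * cmod B * exp (- \<alpha> * s)) (at s)" for s
      unfolding E_def using assms(1)
      by (auto intro!: derivative_eq_intros simp: r_def
          simp flip: has_real_derivative_iff_has_vector_derivative)
    have "cmod (w k T - w k t) \<le> M * r ^ Suc n * exp (- \<alpha> * t)" if "T \<ge> t" for T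
    proof -
      have "cmod (w k T - w k t) \<le> E T - E t"
      proof (rule norm_diff_le_majorant[OF that der E_deriv])
        fix s assume "t < s" "s < T"
        have "cmod (- B * w (Suc k) s) \<le> cmod B * (M * r ^ n * exp (- \<alpha> * s))"
          unfolding norm_mult norm_minus_cancel
          using Suc.IH[of s] \<open>t < s\<close> Suc.prems by (intro mult_left_mono) auto
        thus "cmod (- B * w (Suc k) s) \<le> M * r ^ n * cmod B * exp (- \<alpha> * s)"
          by (simp add: algebra_simps)
      qed
      also have "\<dots> \<le> M * r ^ Suc n * exp (- \<alpha> * t)" using M r(1) by (simp add: E_def)
      finally show ?thesis .
    qed
    hence "\<forall>\<^sub>F T in at_top. cmod (w k T - w k t) \<le> M * r ^ Suc n * exp (- \<alpha> * t)"
      using eventually_at_top_linorder by blast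
    moreover have "(w k \<longlongrightarrow> 0) at_top"
      using taylor_sum_tendsto_0[of \<alpha> "\<lambda>_. w k" M 0 0, OF assms(1) bnd]
      by (simp add: taylor_sum_def[abs_def])
    hence "((\<lambda>T. cmod (w k T - w k t)) \<longlongrightarrow> cmod (0 - w k t)) at_top"
      by (intro tendsto_intros)
    ultimately have "cmod (0 - w k t) \<le> M * r ^ Suc n * exp (- \<alpha> * t)"
      by (intro tendsto_upperbound[of "\<lambda>T. cmod (w k T - w k t)" _ at_top]) auto
    thus ?case by simp
  qed (use bnd in auto)
  have "(\<lambda>n. M * r ^ n) \<longlonglongrightarrow> M * 0"
    using r by (intro tendsto_mult_left LIMSEQ_power_zero) auto
  hence "cmod (w 0 0) \<le> M * 0"
    using bnd_n[of 0 0] by (intro LIMSEQ_le_const) auto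
  thus ?thesis by simp
qed

section \<open>Smooth functions and test functions\<close>

definition smooth :: "(real \<Rightarrow> complex) \<Rightarrow> bool" where
  "smooth \<phi> \<longleftrightarrow> (\<forall>n x. ((\<lambda>g y. vector_derivative g (at y)) ^^ n) \<phi> differentiable (at x))"

abbreviation D :: "(real \<Rightarrow> complex) \<Rightarrow> real \<Rightarrow> complex" where
  "D \<phi> \<equiv> \<lambda>x. vector_derivative \<phi> (at x)"

text \<open>Smoothness by coinduction: it is enough to find a class of functions that contains
  \<open>\<phi>\<close> and in which everything has a derivative in the class. This avoids formulas for
  iterated derivatives.\<close>

lemma smooth_coinduct:
  assumes "P \<phi>"
    and step: "\<And>\<phi>. P \<phi> \<Longrightarrow> \<exists>\<phi>'. (\<forall>x. (\<phi> has_vector_derivative \<phi>' x) (at x)) \<and> P \<phi>'"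
  shows "smooth \<phi>"
proof -
  have P: "P (((\<lambda>g y. vector_derivative g (at y)) ^^ n) \<phi>)" for n
  proof (induction n)
    case (Suc n)
    from step[OF this] obtain \<phi>' where
      "\<forall>x. (((\<lambda>g y. vector_derivative g (at y)) ^^ n) \<phi> has_vector_derivative \<phi>' x) (at x)" "P \<phi>'"
      by blast
    moreover from this have "((\<lambda>g y. vector_derivative g (at y)) ^^ Suc n) \<phi> = \<phi>'"
      by (auto intro!: ext vector_derivative_at)
    ultimately show ?case by simp
  qed (use assms in simp)
  show ?thesis unfolding smooth_def
    using step[OF P] by (meson differentiableI_vector)
qed

lemma smooth_deriv: "smooth \<phi> \<Longrightarrow> (\<phi> has_vector_derivative D \<phi> x) (at x)"
  unfolding smooth_def by (metis funpow_0 vector_derivative_works)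

lemma smooth_D: "smooth \<phi> \<Longrightarrow> smooth (D \<phi>)"
  unfolding smooth_def
proof (intro allI)
  fix n x assume "\<forall>n x. ((\<lambda>g y. vector_derivative g (at y)) ^^ n) \<phi> differentiable at x"
  from this[rule_format, of "Suc n" x]
  show "((\<lambda>g y. vector_derivative g (at y)) ^^ n) (D \<phi>) differentiable at x"
    by (simp only: funpow_Suc_right o_apply)
qed

lemma smooth_continuous: "smooth \<phi> \<Longrightarrow> continuous_on S \<phi>"
  using smooth_deriv continuous_at_imp_continuous_on has_vector_derivative_continuous by blast

text \<open>Products of smooth functions are not stable under differentiation, but their finite sums are;
  this makes coinduction applicable to the product rule.\<close>

inductive sum_of_products :: "(real \<Rightarrow> complex) \<Rightarrow> bool" where
  product: "smooth \<phi> \<Longrightarrow> smooth \<psi> \<Longrightarrow> sum_of_products (\<lambda>x. \<phi> x * \<psi> x)"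
| plus: "sum_of_products f \<Longrightarrow> sum_of_products g \<Longrightarrow> sum_of_products (\<lambda>x. f x + g x)"

lemma smooth_sum_of_products:
  assumes "sum_of_products f"
  shows "smooth f"
proof (rule smooth_coinduct[of sum_of_products, OF assms])
  fix f assume "sum_of_products f"
  thus "\<exists>f'. (\<forall>x. (f has_vector_derivative f' x) (at x)) \<and> sum_of_products f'"
  proof induction
    case (product \<phi> \<psi>)
    have "sum_of_products (\<lambda>x. \<phi> x * D \<psi> x + D \<phi> x * \<psi> x)"
      by (intro sum_of_products.intros product smooth_D)
    with has_vector_derivative_mult[OF smooth_deriv[OF product(1)] smooth_deriv[OF product(2)]]
    show ?case by (intro exI conjI allI)
  next
    case (plus f g)
    then obtain f' g' where "sum_of_products f'" "sum_of_products g'"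
      "\<forall>x. (f has_vector_derivative f' x) (at x)" "\<forall>x. (g has_vector_derivative g' x) (at x)"
      by blast
    thus ?case
      by (intro exI[of _ "\<lambda>x. f' x + g' x"] conjI allI has_vector_derivative_add
          sum_of_products.plus) auto
  qed
qed

lemma smooth_mult: "smooth \<phi> \<Longrightarrow> smooth \<psi> \<Longrightarrow> smooth (\<lambda>x. \<phi> x * \<psi> x)"
  by (rule smooth_sum_of_products[OF sum_of_products.product])

lemma smooth_const: "smooth (\<lambda>_. c)"
  by (rule smooth_coinduct[of "\<lambda>\<phi>. \<exists>c. \<phi> = (\<lambda>_. c)"]) (auto intro: has_vector_derivative_const)

lemma smooth_add:
  assumes "smooth \<phi>" "smooth \<psi>"
  shows "smooth (\<lambda>x. \<phi> x + \<psi> x)"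
proof -
  have "sum_of_products (\<lambda>x. \<phi> x * 1 + \<psi> x * 1)"
    by (rule sum_of_products.plus) (rule sum_of_products.product assms smooth_const)+
  from smooth_sum_of_products[OF this] show ?thesis by simp
qed

lemma smooth_affine:
  assumes "smooth \<phi>"
  shows "smooth (\<lambda>x. \<phi> (a * x + b))"
proof (rule smooth_coinduct[of "\<lambda>f. \<exists>\<psi> c. smooth \<psi> \<and> f = (\<lambda>x. c *\<^sub>R \<psi> (a * x + b))"])
  show "\<exists>\<psi> c. smooth \<psi> \<and> (\<lambda>x. \<phi> (a * x + b)) = (\<lambda>x. c *\<^sub>R \<psi> (a * x + b))"
    using assms by (intro exI[of _ \<phi>] exI[of _ 1]) simp
next
  fix f assume "\<exists>\<psi> c. smooth \<psi> \<and> f = (\<lambda>x. c *\<^sub>R \<psi> (a * x + b))"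
  then obtain \<psi> c where \<psi>: "smooth \<psi>" and f: "f = (\<lambda>x. c *\<^sub>R \<psi> (a * x + b))" by blast
  have "(f has_vector_derivative (c * a) *\<^sub>R D \<psi> (a * x + b)) (at x)" for x
  proof -
    have "((\<lambda>x. a * x + b) has_vector_derivative a) (at x)"
      by (auto intro!: derivative_eq_intros simp flip: has_real_derivative_iff_has_vector_derivative)
    from bounded_linear.has_vector_derivative[OF bounded_linear_scaleR_right[of c]
        vector_diff_chain_at[OF this smooth_deriv[OF \<psi>]]]
    show ?thesis by (simp add: f o_def)
  qed
  thus "\<exists>f'. (\<forall>x. (f has_vector_derivative f' x) (at x)) \<and>
      (\<exists>\<psi> c. smooth \<psi> \<and> f' = (\<lambda>x. c *\<^sub>R \<psi> (a * x + b)))"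
    by (intro exI[of _ "\<lambda>x. (c * a) *\<^sub>R D \<psi> (a * x + b)"] conjI allI
        exI[of _ "D \<psi>"] exI[of _ "c * a"] smooth_D[OF \<psi>] refl) auto
qed

lemma exp_linear_deriv:
  "((\<lambda>x::real. exp (c * of_real x :: complex)) has_vector_derivative c * exp (c * of_real x)) (at x)"
  by (rule has_vector_derivative_real_field[of "\<lambda>z. exp (c * z)"])
     (auto intro!: derivative_eq_intros)

lemma smooth_exp: "smooth (\<lambda>x. exp (c * of_real x))"
proof (rule smooth_coinduct[of "\<lambda>f. \<exists>k. f = (\<lambda>x. k * exp (c * of_real x))"])
  show "\<exists>k. (\<lambda>x. exp (c * of_real x)) = (\<lambda>x::real. k * exp (c * of_real x))"
    by (intro exI[of _ 1]) simp
next
  fix f assume "\<exists>k. f = (\<lambda>x. k * exp (c * complex_of_real x))"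
  then obtain k where "f = (\<lambda>x. k * exp (c * complex_of_real x))" by blast
  thus "\<exists>f'. (\<forall>x. (f has_vector_derivative f' x) (at x)) \<and> (\<exists>k. f' = (\<lambda>x. k * exp (c * complex_of_real x)))"
    using has_vector_derivative_mult_right[OF exp_linear_deriv[of c], of k]
    by (intro exI[of _ "\<lambda>x. (k * c) * exp (c * complex_of_real x)"] conjI allI exI[of _ "k * c"])
       (auto simp: mult.assoc)
qed

text \<open>For \<open>p = 1\<close>, the standard example of a smooth function that is not analytic; the polynomial
  factors in \<open>1 / x\<close> make the family closed under differentiation.\<close>

definition flat :: "real poly \<Rightarrow> real \<Rightarrow> real" where
  "flat p x = (if x \<le> 0 then 0 else poly p (1 / x) * exp (- (1 / x)))"

lemma poly_div_exp_tendsto_0: "((\<lambda>y. poly p y / exp y) \<longlongrightarrow> 0) at_top" for p :: "real poly"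
proof -
  have "(\<lambda>y. poly p y / exp y) = (\<lambda>y. \<Sum>i\<le>degree p. coeff p i * (y ^ i / exp y))"
    by (simp add: poly_altdef sum_divide_distrib)
  thus ?thesis
    by (simp only:) (intro tendsto_null_sum tendsto_mult_right_zero tendsto_power_div_exp_0)
qed

lemma flat_deriv:
  "(flat p has_real_derivative flat (monom 1 2 * (p - pderiv p)) x) (at x)"
proof -
  consider "x < 0" | "x > 0" | "x = 0" by linarith
  thus ?thesis
  proof cases
    case 1
    have "(flat p has_real_derivative 0) (at x)"
      by (rule has_field_derivative_transform_within_open[where f = "\<lambda>_. 0" and S = "{..<0}"])
         (use 1 in \<open>auto simp: flat_def\<close>)
    thus ?thesis using 1 by (simp add: flat_def)
  next
    case 2
    have "((\<lambda>x. poly p (1 / x) * exp (- (1 / x))) has_real_derivative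
        flat (monom 1 2 * (p - pderiv p)) x) (at x)"
      using 2 by (auto intro!: derivative_eq_intros
          simp: flat_def poly_monom field_simps power2_eq_square)
    thus ?thesis
      by (rule has_field_derivative_transform_within_open[where S = "{0<..}"])
         (use 2 in \<open>auto simp: flat_def\<close>)
  next
    case 3
    have "((\<lambda>h. (flat p (0 + h) - flat p 0) / h) \<longlongrightarrow> 0) (at 0)"
    proof (rule filterlim_split_at)
      show "((\<lambda>h. (flat p (0 + h) - flat p 0) / h) \<longlongrightarrow> 0) (at_left 0)"
        by (rule tendsto_eventually) (auto simp: flat_def eventually_at_filter)
      have "((\<lambda>y. poly (pCons 0 p) y / exp y) \<longlongrightarrow> 0) at_top" by (rule poly_div_exp_tendsto_0)
      moreover have "\<forall>\<^sub>F y in at_top. poly (pCons 0 p) y / exp y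
          = (flat p (0 + inverse y) - flat p 0) / inverse y"
        using eventually_gt_at_top[of 0]
        by eventually_elim (auto simp: flat_def exp_minus field_simps)
      ultimately show "((\<lambda>h. (flat p (0 + h) - flat p 0) / h) \<longlongrightarrow> 0) (at_right 0)"
        unfolding filterlim_at_right_to_top by (rule Lim_transform_eventually)
    qed
    thus ?thesis using 3 by (simp add: DERIV_def flat_def)
  qed
qed

lemma smooth_flat: "smooth (\<lambda>x. of_real (flat p x))"
proof (rule smooth_coinduct[of "\<lambda>f. \<exists>p. f = (\<lambda>x. of_real (flat p x))"])
  fix f assume "\<exists>p. f = (\<lambda>x. complex_of_real (flat p x))"
  then obtain p where "f = (\<lambda>x. complex_of_real (flat p x))" by blast
  thus "\<exists>f'. (\<forall>x. (f has_vector_derivative f' x) (at x)) \<and> (\<exists>p. f' = (\<lambda>x. complex_of_real (flat p x)))"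
    using has_vector_derivative_of_real[OF flat_deriv[of p]]
    by (intro exI[of _ "\<lambda>x. complex_of_real (flat (monom 1 2 * (p - pderiv p)) x)"]) auto
qed blast

text \<open>Both factors tend to \<open>1\<close> where their argument is positive and vanish elsewhere, so letting the slope
  \<open>n\<close> grow approximates the indicator of the interval from \<open>a\<close> to \<open>b\<close> boundedly, without a
  smooth step function or a convolution.\<close>

definition bump :: "real \<Rightarrow> real \<Rightarrow> nat \<Rightarrow> real \<Rightarrow> real" where
  "bump a b n x = flat 1 (real n * (x - a)) * flat 1 (real n * (b - x))"

lemma flat_1_bounds: "0 \<le> flat 1 x" "flat 1 x \<le> 1"
  by (auto simp: flat_def)

lemma bump_tendsto_indicator:
  "(\<lambda>n. bump a b n x) \<longlonglongrightarrow> indicator {a<..<b} x"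
proof -
  have flat: "(\<lambda>n. flat 1 (real n * y)) \<longlonglongrightarrow> (if y > 0 then 1 else 0)" for y
  proof (cases "y > 0")
    case True
    have "(\<lambda>n. exp (- (inverse y * inverse (real n)))) \<longlonglongrightarrow> exp (- (inverse y * 0))"
      by (intro tendsto_intros lim_inverse_n)
    moreover have "\<forall>\<^sub>F n in sequentially.
        exp (- (inverse y * inverse (real n))) = flat 1 (real n * y)"
      using eventually_gt_at_top[of 0]
      by eventually_elim (use True in \<open>auto simp: flat_def field_simps mult_le_0_iff\<close>)
    ultimately show ?thesis using True by (simp add: Lim_transform_eventually)
  next
    case False
    hence "flat 1 (real n * y) = 0" for n by (auto simp: flat_def mult_nonneg_nonpos)
    thus ?thesis using False by simp
  qed
  have "(\<lambda>n. bump a b n x) \<longlonglongrightarrow> (if x - a > 0 then 1 else 0) * (if b - x > 0 then 1 else 0)"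
    unfolding bump_def by (intro tendsto_mult flat)
  thus ?thesis by (simp add: indicator_def split: if_splits)
qed

lemma test_function_iff:
  "test_function \<phi> \<longleftrightarrow> smooth \<phi> \<and> (\<exists>R>0. \<forall>x. \<bar>x\<bar> > R \<longrightarrow> \<phi> x = 0)"
proof -
  have "compact (closure {x. \<phi> x \<noteq> 0}) \<longleftrightarrow> bounded {x. \<phi> x \<noteq> 0}"
    by (simp add: compact_closure)
  also have "\<dots> \<longleftrightarrow> (\<exists>R>0. \<forall>x. \<bar>x\<bar> > R \<longrightarrow> \<phi> x = 0)"
    unfolding bounded_pos real_norm_def by (auto simp: not_less) (meson not_less)+
  finally show ?thesis unfolding test_function_def smooth_def by simp
qed

lemma test_function_support:
  assumes "test_function \<phi>"
  obtains R where "R > 0" "\<And>x. \<bar>x\<bar> > R \<Longrightarrow> \<phi> x = 0"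
  using assms unfolding test_function_iff by blast

lemma test_function_smooth: "test_function \<phi> \<Longrightarrow> smooth \<phi>"
  unfolding test_function_iff by blast

lemma test_function_mult_smooth:
  "smooth g \<Longrightarrow> test_function \<phi> \<Longrightarrow> test_function (\<lambda>x. g x * \<phi> x)"
  unfolding test_function_iff using smooth_mult by auto

lemma test_function_add:
  assumes "test_function \<phi>" "test_function \<psi>"
  shows "test_function (\<lambda>x. \<phi> x + \<psi> x)"
proof -
  obtain R S where "R > 0" "\<And>x. \<bar>x\<bar> > R \<Longrightarrow> \<phi> x = 0" "S > 0" "\<And>x. \<bar>x\<bar> > S \<Longrightarrow> \<psi> x = 0"
    using assms by (meson test_function_support)
  thus ?thesis using assms smooth_add unfolding test_function_iff
    by (auto intro!: exI[of _ "max R S"])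
qed

lemma test_function_D:
  assumes "test_function \<phi>"
  shows "test_function (D \<phi>)"
proof -
  obtain R where R: "R > 0" "\<And>x. \<bar>x\<bar> > R \<Longrightarrow> \<phi> x = 0"
    using test_function_support[OF assms] by blast
  have "D \<phi> x = 0" if "\<bar>x\<bar> > R" for x
  proof -
    have "open {x::real. \<bar>x\<bar> > R}" by (intro open_Collect_less continuous_intros)
    hence "(\<phi> has_vector_derivative 0) (at x)"
      using that R(2) has_vector_derivative_transform_within_open[of "\<lambda>_. 0" 0 x "{x. \<bar>x\<bar> > R}" \<phi>]
      by auto
    thus ?thesis by (rule vector_derivative_at)
  qed
  with R(1) show ?thesis using smooth_D[OF test_function_smooth[OF assms]]
    unfolding test_function_iff by blast
qed

lemma test_function_translate:
  assumes "test_function \<phi>"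
  shows "test_function (\<lambda>y. \<phi> (y - x))"
proof -
  obtain R where R: "R > 0" "\<And>x. \<bar>x\<bar> > R \<Longrightarrow> \<phi> x = 0"
    using test_function_support[OF assms] by blast
  have "\<phi> (y - x) = 0" if "\<bar>y\<bar> > R + \<bar>x\<bar>" for y using that by (intro R(2)) linarith
  moreover have "smooth (\<lambda>y. \<phi> (y - x))"
    using smooth_affine[OF test_function_smooth[OF assms], of 1 "-x"] by simp
  ultimately show ?thesis using R(1) unfolding test_function_iff
    by (intro conjI exI[of _ "R + \<bar>x\<bar>"]) auto
qed

lemma D_translate:
  assumes "smooth \<phi>"
  shows "D (\<lambda>y. \<phi> (y - x)) = (\<lambda>y. D \<phi> (y - x))"
proof
  fix y
  have "((\<lambda>y. y - x) has_vector_derivative 1) (at y)"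
    by (auto intro!: derivative_eq_intros simp flip: has_real_derivative_iff_has_vector_derivative)
  from vector_diff_chain_at[OF this smooth_deriv[OF assms]]
  show "D (\<lambda>y. \<phi> (y - x)) y = D \<phi> (y - x)"
    by (intro vector_derivative_at) (simp add: o_def)
qed

lemma test_function_bounded:
  assumes "test_function \<phi>"
  obtains C where "C > 0" "\<And>x. cmod (\<phi> x) \<le> C"
proof -
  obtain R where R: "R > 0" "\<And>x. \<bar>x\<bar> > R \<Longrightarrow> \<phi> x = 0"
    using test_function_support[OF assms] by blast
  have "compact (\<phi> ` {-R..R})"
    by (intro compact_continuous_image smooth_continuous test_function_smooth assms compact_Icc)
  then obtain C where C: "C > 0" "\<forall>y \<in> \<phi> ` {-R..R}. cmod y \<le> C"
    using compact_imp_bounded bounded_pos by metis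
  have "cmod (\<phi> x) \<le> C" for x
    by (cases "\<bar>x\<bar> > R") (use C R in \<open>auto simp: abs_le_iff not_less\<close>)
  with C(1) show ?thesis using that by blast
qed

lemma test_function_bump: "test_function (\<lambda>x. of_real (bump a b n x))"
proof -
  have "smooth (\<lambda>x. complex_of_real (flat 1 (real n * x + - (real n * a)))
      * complex_of_real (flat 1 ((- real n) * x + real n * b)))"
    by (intro smooth_mult smooth_affine[of "\<lambda>x. of_real (flat 1 x)"] smooth_flat)
  hence "smooth (\<lambda>x. of_real (bump a b n x))"
    by (simp add: bump_def algebra_simps)
  moreover have "bump a b n x = 0" if "\<bar>x\<bar> > \<bar>a\<bar> + \<bar>b\<bar> + 1" for x
  proof -
    from that have "x - a \<le> 0 \<or> b - x \<le> 0" by linarith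
    thus ?thesis by (auto simp: bump_def flat_def mult_nonneg_nonpos)
  qed
  ultimately show ?thesis unfolding test_function_iff
    by (intro conjI exI[of _ "\<bar>a\<bar> + \<bar>b\<bar> + 1"]) auto
qed

section \<open>Integration against test functions\<close>

definition locally_integrable :: "(real \<Rightarrow> complex) \<Rightarrow> bool" where
  "locally_integrable u \<longleftrightarrow> (\<forall>a b. set_integrable lebesgue {a..b} u)"

lemma continuous_borel_measurable_lebesgue:
  fixes g :: "real \<Rightarrow> 'a::{second_countable_topology, banach}"
  shows "continuous_on UNIV g \<Longrightarrow> g \<in> borel_measurable lebesgue"
  by (intro measurable_completion) (simp add: borel_measurable_continuous_onI)

lemma locally_integrable_mult_continuous:
  assumes u: "locally_integrable u" and g: "continuous_on UNIV g"
  shows "locally_integrable (\<lambda>x. g x * u x)"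
  unfolding locally_integrable_def
proof (intro allI)
  fix a b :: real
  have int: "integrable lebesgue (\<lambda>x. indicator {a..b} x *\<^sub>R u x)"
    using u by (simp add: locally_integrable_def set_integrable_def)
  have "compact (g ` {a..b})"
    by (intro compact_continuous_image continuous_on_subset[OF g]) auto
  then obtain C where C: "C > 0" "\<forall>y \<in> g ` {a..b}. cmod y \<le> C"
    using compact_imp_bounded bounded_pos by metis
  have "integrable lebesgue (\<lambda>x. g x * (indicator {a..b} x *\<^sub>R u x))"
  proof (rule Bochner_Integration.integrable_bound)
    show "integrable lebesgue (\<lambda>x. C *\<^sub>R (indicator {a..b} x *\<^sub>R u x))"
      using int by (rule integrable_scaleR_right)
    show "(\<lambda>x. g x * (indicator {a..b} x *\<^sub>R u x)) \<in> borel_measurable lebesgue"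
      by (intro borel_measurable_times continuous_borel_measurable_lebesgue g
          borel_measurable_integrable int)
    show "AE x in lebesgue. norm (g x * (indicator {a..b} x *\<^sub>R u x))
        \<le> norm (C *\<^sub>R (indicator {a..b} x *\<^sub>R u x))"
      using C by (auto simp: norm_mult indicator_def intro!: mult_right_mono AE_I2)
  qed
  thus "set_integrable lebesgue {a..b} (\<lambda>x. g x * u x)"
    by (simp add: set_integrable_def mult_ac)
qed

lemma locally_integrable_continuous:
  assumes "continuous_on UNIV g"
  shows "locally_integrable g"
  unfolding locally_integrable_def
proof (intro allI)
  fix a b :: real
  have "set_integrable lborel {a..b} g"
    by (intro borel_integrable_atLeastAtMost' continuous_on_subset[OF assms]) auto
  thus "set_integrable lebesgue {a..b} g"
    unfolding set_integrable_def by (subst integrable_completion) auto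
qed

lemma locally_integrable_bounded:
  assumes "u \<in> borel_measurable lebesgue" "continuous_on UNIV v" "\<And>x. cmod (u x) \<le> v x"
  shows "locally_integrable u"
  unfolding locally_integrable_def
proof (intro allI)
  fix a b :: real
  have v: "set_integrable lebesgue {a..b} (\<lambda>x. complex_of_real (v x))"
    using locally_integrable_continuous[of "\<lambda>x. of_real (v x)"] assms(2)
    by (auto simp: locally_integrable_def intro: continuous_intros)
  show "set_integrable lebesgue {a..b} u"
    unfolding set_integrable_def
  proof (rule Bochner_Integration.integrable_bound[OF v[unfolded set_integrable_def]])
    show "(\<lambda>x. indicator {a..b} x *\<^sub>R u x) \<in> borel_measurable lebesgue"
      using assms(1) by (intro borel_measurable_scaleR borel_measurable_indicator) auto
    show "AE x in lebesgue. norm (indicator {a..b} x *\<^sub>R u x)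
        \<le> norm (indicator {a..b} x *\<^sub>R complex_of_real (v x))"
      using assms(3) by (intro AE_I2) (auto simp: indicator_def intro: order_trans[OF _ abs_ge_self])
  qed
qed

lemma locally_integrable_diff:
  "locally_integrable u \<Longrightarrow> locally_integrable v \<Longrightarrow> locally_integrable (\<lambda>x. u x - v x)"
  unfolding locally_integrable_def by (simp add: set_integral_diff)

lemma integrable_mult_test_function:
  assumes "locally_integrable u" "test_function \<phi>"
  shows "integrable lebesgue (\<lambda>x. u x * \<phi> x)"
proof -
  obtain R where R: "R > 0" "\<And>x. \<bar>x\<bar> > R \<Longrightarrow> \<phi> x = 0"
    using test_function_support[OF assms(2)] by blast
  have "locally_integrable (\<lambda>x. \<phi> x * u x)"
    by (intro locally_integrable_mult_continuous assms smooth_continuous test_function_smooth)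
  hence "integrable lebesgue (\<lambda>x. indicator {-R..R} x *\<^sub>R (\<phi> x * u x))"
    by (simp add: locally_integrable_def set_integrable_def)
  also have "(\<lambda>x. indicator {-R..R} x *\<^sub>R (\<phi> x * u x)) = (\<lambda>x. u x * \<phi> x)"
    using R(2) by (auto simp: indicator_def fun_eq_iff)
  finally show ?thesis .
qed

lemma integral_deriv_compact_support:
  fixes G :: "real \<Rightarrow> complex"
  assumes "R > 0" "\<And>x. (G has_vector_derivative G' x) (at x)" "continuous_on UNIV G'"
    and "\<And>x. \<bar>x\<bar> > R \<Longrightarrow> G' x = 0"
  shows "(LINT x|lebesgue. G' x) = G R - G (-R)"
proof -
  have "(LINT x|lebesgue. G' x) = (LINT x|lborel. G' x)"
    by (rule integral_completion) (simp add: borel_measurable_continuous_onI[OF assms(3)])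
  also have "\<dots> = (LINT x|lborel. indicator {-R..R} x *\<^sub>R G' x)"
    by (rule Bochner_Integration.integral_cong) (use assms(4) in \<open>auto simp: indicator_def\<close>)
  also have "(LINT x|lborel. indicator {-R..R} x *\<^sub>R G' x) = G R - G (-R)"
    using assms(1) by (intro integral_FTC_atLeastAtMost has_vector_derivative_at_within[OF assms(2)]
        continuous_on_subset[OF assms(3)]) auto
  finally show ?thesis .
qed

lemma integral_by_parts_test_function:
  assumes F: "\<And>x. (F has_vector_derivative F' x) (at x)" "continuous_on UNIV F'"
    and \<phi>: "test_function \<phi>"
  shows "(LINT x|lebesgue. F x * D \<phi> x) = - (LINT x|lebesgue. F' x * \<phi> x)"
proof -
  obtain R where R: "R > 0" "\<And>x. \<bar>x\<bar> > R \<Longrightarrow> \<phi> x = 0"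
    using test_function_support[OF \<phi>] by blast
  obtain S where S: "S > 0" "\<And>x. \<bar>x\<bar> > S \<Longrightarrow> D \<phi> x = 0"
    using test_function_support[OF test_function_D[OF \<phi>]] by blast
  have F_cont: "continuous_on UNIV F"
    using F(1) by (meson continuous_at_imp_continuous_on has_vector_derivative_continuous)
  have s: "smooth \<phi>" "smooth (D \<phi>)" using \<phi> test_function_smooth test_function_D by auto
  define T where "T = max R S + 1"
  have "(LINT x|lebesgue. F x * D \<phi> x + F' x * \<phi> x) = F T * \<phi> T - F (-T) * \<phi> (-T)"
  proof (rule integral_deriv_compact_support)
    show "((\<lambda>x. F x * \<phi> x) has_vector_derivative F x * D \<phi> x + F' x * \<phi> x) (at x)" for x
      by (intro has_vector_derivative_mult F smooth_deriv s)
    show "continuous_on UNIV (\<lambda>x. F x * D \<phi> x + F' x * \<phi> x)"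
      by (intro continuous_intros F_cont F smooth_continuous s)
  qed (use R S in \<open>auto simp: T_def\<close>)
  also have "\<dots> = 0" using R by (simp add: T_def)
  also have "(LINT x|lebesgue. F x * D \<phi> x + F' x * \<phi> x) =
      (LINT x|lebesgue. F x * D \<phi> x) + (LINT x|lebesgue. F' x * \<phi> x)"
    by (intro Bochner_Integration.integral_add integrable_mult_test_function \<phi> test_function_D
        locally_integrable_continuous F_cont F)
  finally show ?thesis by (simp add: add_eq_0_iff)
qed

text \<open>Dominated convergence along the bumps on the interval.\<close>

lemma integral_open_interval_eq_0:
  assumes u: "locally_integrable u"
    and zero: "\<And>\<phi>. test_function \<phi> \<Longrightarrow> (LINT x|lebesgue. u x * \<phi> x) = 0"
  shows "(LINT x:{a<..<b}|lebesgue. u x) = 0"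
proof -
  have int: "integrable lebesgue (\<lambda>x. indicator {a..b} x *\<^sub>R u x)"
    using u by (simp add: locally_integrable_def set_integrable_def)
  have "(\<lambda>n. LINT x|lebesgue. u x * of_real (bump a b n x))
      \<longlonglongrightarrow> (LINT x|lebesgue. indicator {a<..<b} x *\<^sub>R u x)"
  proof (rule integral_dominated_convergence[where w = "\<lambda>x. norm (indicator {a..b} x *\<^sub>R u x)"])
    show "(\<lambda>x. u x * of_real (bump a b n x)) \<in> borel_measurable lebesgue" for n
      by (intro borel_measurable_integrable integrable_mult_test_function u test_function_bump)
    show "integrable lebesgue (\<lambda>x. norm (indicator {a..b} x *\<^sub>R u x))"
      using int by (rule integrable_norm)
    have "(\<lambda>x. indicator {a<..<b} x *\<^sub>R u x)
        = (\<lambda>x. indicator {a<..<b} x *\<^sub>R (indicator {a..b} x *\<^sub>R u x))"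
      by (auto simp: indicator_def fun_eq_iff)
    also have "\<dots> \<in> borel_measurable lebesgue"
      by (intro borel_measurable_scaleR borel_measurable_integrable[OF int]
          borel_measurable_indicator) auto
    finally show "(\<lambda>x. indicator {a<..<b} x *\<^sub>R u x) \<in> borel_measurable lebesgue" .
    show "AE x in lebesgue. (\<lambda>n. u x * of_real (bump a b n x))
        \<longlonglongrightarrow> indicator {a<..<b} x *\<^sub>R u x"
    proof (intro AE_I2)
      fix x
      have "(\<lambda>n. u x * of_real (bump a b n x)) \<longlonglongrightarrow> u x * of_real (indicator {a<..<b} x)"
        by (intro tendsto_intros bump_tendsto_indicator)
      thus "(\<lambda>n. u x * of_real (bump a b n x)) \<longlonglongrightarrow> indicator {a<..<b} x *\<^sub>R u x"
        by (simp add: scaleR_conv_of_real mult.commute)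
    qed
    show "AE x in lebesgue. norm (u x * of_real (bump a b n x))
        \<le> norm (indicator {a..b} x *\<^sub>R u x)" for n
    proof (intro AE_I2)
      fix x
      have "\<bar>bump a b n x\<bar> \<le> indicator {a..b} x"
      proof (cases "x \<in> {a..b}")
        case True
        thus ?thesis unfolding bump_def
          using mult_le_one[OF flat_1_bounds(2) flat_1_bounds(1) flat_1_bounds(2)]
          by (simp add: abs_mult flat_1_bounds)
      next
        case False
        hence "x - a \<le> 0 \<or> b - x \<le> 0" by auto
        thus ?thesis by (auto simp: bump_def flat_def mult_nonneg_nonpos)
      qed
      hence "norm (u x) * \<bar>bump a b n x\<bar> \<le> norm (u x) * indicator {a..b} x"
        by (rule mult_left_mono) simp
      thus "norm (u x * of_real (bump a b n x)) \<le> norm (indicator {a..b} x *\<^sub>R u x)"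
        by (simp add: norm_mult mult.commute)
    qed
  qed
  thus ?thesis using LIMSEQ_unique[OF tendsto_const[of 0]]
    by (simp add: zero test_function_bump set_lebesgue_integral_def)
qed

lemma sigma_finite_measure_lebesgue: "sigma_finite_measure (lebesgue :: real measure)"
proof
  obtain A :: "real set set" where A: "countable A" "A \<subseteq> sets lborel" "\<Union>A = space lborel"
    "\<forall>a\<in>A. emeasure lborel a \<noteq> \<infinity>"
    using lborel.sigma_finite_countable by blast
  thus "\<exists>A. countable A \<and> A \<subseteq> sets lebesgue \<and> \<Union>A = space (lebesgue :: real measure) \<and>
      (\<forall>a\<in>A. emeasure lebesgue a \<noteq> \<infinity>)"
    by (intro exI[of _ A]) (auto simp: subset_iff)
qed

text \<open>Open intervals form an intersection-stable generator of the Borel sets, and Lebesgue sets differ from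
  Borel sets by null sets.\<close>

lemma set_integral_sets_eq_0:
  fixes v :: "real \<Rightarrow> complex"
  assumes v: "integrable lebesgue v"
    and box: "\<And>a b. (LINT x:{a<..<b}|lebesgue. v x) = 0"
    and whole: "(LINT x|lebesgue. v x) = 0"
    and A: "A \<in> sets lebesgue"
  shows "(LINT x:A|lebesgue. v x) = 0"
proof -
  have set_int: "set_integrable lebesgue B v" if "B \<in> sets lebesgue" for B
    using v that unfolding set_integrable_def by (intro integrable_mult_indicator)
  have borel: "(LINT x:B|lebesgue. v x) = 0" if "B \<in> sets borel" for B
  proof -
    have sets: "sets (borel :: real measure) = sigma_sets UNIV (range (\<lambda>(a, b). {a<..<b}))"
      using arg_cong[OF borel_eq_box[where 'a = real], of sets] unfolding box_real by simp
    have stable: "Int_stable (range (\<lambda>(a, b). {a<..<b::real}))"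
    proof (rule Int_stableI)
      fix B C assume "B \<in> range (\<lambda>(a, b). {a<..<b::real})" "C \<in> range (\<lambda>(a, b). {a<..<b::real})"
      then obtain a b c d where "B = {a<..<b}" "C = {c<..<d}" by auto
      hence "B \<inter> C = (\<lambda>(a, b). {a<..<b}) (max a c, min b d)" by auto
      thus "B \<inter> C \<in> range (\<lambda>(a, b). {a<..<b::real})" by blast
    qed
    have "range (\<lambda>(a, b). {a<..<b::real}) \<subseteq> Pow UNIV" by simp
    with stable show ?thesis using that[unfolded sets]
    proof (induction rule: sigma_sets_induct_disjoint)
      case (compl B)
      hence B: "B \<in> sets lebesgue" unfolding sets[symmetric] by simp
      have "(LINT x:B \<union> (UNIV - B)|lebesgue. v x)
          = (LINT x:B|lebesgue. v x) + (LINT x:UNIV - B|lebesgue. v x)"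
        using B by (intro set_integral_Un set_int) auto
      with compl whole show ?case by (simp add: set_lebesgue_integral_def)
    next
      case (union B)
      hence B: "B i \<in> sets lebesgue" for i unfolding sets[symmetric] by (auto simp: image_subset_iff)
      have "(LINT x:(\<Union>i. B i)|lebesgue. v x) = (\<Sum>i. LINT x:B i|lebesgue. v x)"
        using union B by (intro lebesgue_integral_countable_add set_int) (auto simp: disjoint_family_on_def)
      with union show ?case by simp
    qed (use box in \<open>auto simp: set_lebesgue_integral_def\<close>)
  qed
  obtain S N N' where SN: "A = S \<union> N" "N \<subseteq> N'" "N' \<in> null_sets lborel" "S \<in> sets lborel"
    using A by (rule sets_completionE)
  have "(LINT x:A|lebesgue. v x) = (LINT x:S|lebesgue. v x)"
  proof (rule set_integral_cong_set)
    have "S \<in> sets lebesgue" using SN(4) by (rule sets_completionI_sets)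
    thus "set_borel_measurable lebesgue A v" "set_borel_measurable lebesgue S v"
      using set_int A unfolding set_borel_measurable_def set_integrable_def
      by (blast intro: borel_measurable_integrable)+
    show "AE x in lebesgue. (x \<in> S) = (x \<in> A)"
      using AE_not_in[OF null_sets_completionI[OF SN(3)]] by (rule AE_mp)
        (use SN(1,2) in \<open>auto intro!: AE_I2\<close>)
  qed
  thus ?thesis using borel SN(4) by simp
qed

text \<open>The fundamental lemma of the calculus of variations. It is reduced to integrable functions by
  truncating to a bounded interval.\<close>

lemma AE_eq_0_if_orthogonal_to_test_functions:
  assumes u: "locally_integrable u"
    and zero: "\<And>\<phi>. test_function \<phi> \<Longrightarrow> (LINT x|lebesgue. u x * \<phi> x) = 0"
  shows "AE x in lebesgue. u x = 0"
proof -
  have "AE x in lebesgue. indicator {-real N<..<real N} x *\<^sub>R u x = 0" for N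
  proof (rule sigma_finite_measure.density_zero[OF sigma_finite_measure_lebesgue])
    let ?v = "\<lambda>x. indicator {-real N<..<real N} x *\<^sub>R u x"
    have "set_integrable lebesgue {-real N<..<real N} u"
      by (rule set_integrable_subset[where A = "{-real N..real N}"])
         (use u in \<open>auto simp: locally_integrable_def\<close>)
    thus int: "integrable lebesgue ?v" by (simp add: set_integrable_def)
    show "(LINT x:A|lebesgue. ?v x) = 0" if "A \<in> sets lebesgue" for A
    proof (rule set_integral_sets_eq_0[OF int _ _ that])
      show "(LINT x|lebesgue. ?v x) = 0"
        using integral_open_interval_eq_0[OF u zero] by (simp add: set_lebesgue_integral_def)
      show "(LINT x:{a<..<b}|lebesgue. ?v x) = 0" for a b
      proof -
        have "(LINT x:{a<..<b}|lebesgue. ?v x)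
            = (LINT x:{max a (-real N)<..<min b (real N)}|lebesgue. u x)"
          unfolding set_lebesgue_integral_def
          by (rule Bochner_Integration.integral_cong) (auto simp: indicator_def)
        also have "\<dots> = 0" by (rule integral_open_interval_eq_0[OF u zero])
        finally show ?thesis .
      qed
    qed
  qed
  hence "AE x in lebesgue. \<forall>N. indicator {-real N<..<real N} x *\<^sub>R u x = 0"
    by (rule iffD2[OF AE_all_countable, rule_format])
  thus ?thesis
  proof eventually_elim
    case (elim x)
    obtain N where "real N > \<bar>x\<bar>" using reals_Archimedean2 by blast
    with elim[rule_format, of N] show ?case by (simp add: indicator_def abs_less_iff split: if_splits)
  qed
qed

section \<open>Regularising a weak chain by translated test functions\<close>

text \<open>Up to a reflection of \<open>\<psi>\<close>, this is the convolution of \<open>u\<close> with \<open>\<psi>\<close>; at \<open>x = 0\<close> it is the value of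
  the distribution \<open>u\<close> at \<open>\<psi>\<close>.\<close>

definition pairing :: "(real \<Rightarrow> complex) \<Rightarrow> (real \<Rightarrow> complex) \<Rightarrow> real \<Rightarrow> complex" where
  "pairing u \<psi> x = regular_dist u (\<lambda>y. \<psi> (y - x))"

lemma smooth_second_order_remainder:
  assumes "smooth \<psi>" "\<And>x. cmod (D (D \<psi>) x) \<le> C"
  shows "cmod (\<psi> (a - h) - \<psi> a + h *\<^sub>R D \<psi> a) \<le> C * h\<^sup>2"
proof -
  have lip: "cmod (D \<psi> s - D \<psi> t) \<le> C * \<bar>s - t\<bar>" for s t
  proof -
    have "cmod (D \<psi> s - D \<psi> t) \<le> C * norm (s - t)"
    proof (rule differentiable_bound[of UNIV "D \<psi>" "\<lambda>x h. h *\<^sub>R D (D \<psi>) x"])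
      show "(D \<psi> has_derivative (\<lambda>h. h *\<^sub>R D (D \<psi>) x)) (at x within UNIV)" for x
        using smooth_deriv[OF smooth_D[OF assms(1)]] by (simp only: has_vector_derivative_def)
      show "onorm (\<lambda>h. h *\<^sub>R D (D \<psi>) x) \<le> C" for x
        by (rule onorm_le) (use assms(2)[of x] in \<open>simp add: mult.commute[of C] mult_left_mono\<close>)
    qed auto
    thus ?thesis by simp
  qed
  have C: "C \<ge> 0" by (rule order_trans[OF norm_ge_zero assms(2)[of 0]])
  have "cmod (\<psi> (a - h) - \<psi> a - ((a - h) - a) *\<^sub>R D \<psi> a) \<le> norm ((a - h) - a) * (C * \<bar>h\<bar>)"
  proof (rule vector_differentiable_bound_linearization[of "closed_segment a (a - h)" \<psi> "D \<psi>"
        a "a - h" a "C * \<bar>h\<bar>"])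
    show "(\<psi> has_vector_derivative D \<psi> x) (at x within closed_segment a (a - h))" for x
      by (rule has_vector_derivative_at_within[OF smooth_deriv[OF assms(1)]])
    show "cmod (D \<psi> x - D \<psi> a) \<le> C * \<bar>h\<bar>" if "x \<in> closed_segment a (a - h)" for x
    proof -
      have "\<bar>x - a\<bar> \<le> \<bar>h\<bar>" using that by (auto simp: closed_segment_eq_real_ivl split: if_splits)
      hence "C * \<bar>x - a\<bar> \<le> C * \<bar>h\<bar>" using C by (rule mult_left_mono)
      with lip[of x a] show ?thesis by linarith
    qed
  qed auto
  thus ?thesis by (simp add: power2_eq_square algebra_simps)
qed

text \<open>Since \<open>u\<close> is merely measurable, all regularity comes from \<open>\<psi>\<close>: the second-order Taylor
  remainder of \<open>\<psi>\<close> is at most \<open>C h\<^sup>2\<close>, and for \<open>|h| < 1\<close> it is supported in a fixed compact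
  interval \<open>J\<close>, on which \<open>u\<close> is integrable.\<close>

lemma pairing_deriv:
  assumes u: "locally_integrable u" and \<psi>: "test_function \<psi>"
  shows "(pairing u \<psi> has_vector_derivative - pairing u (D \<psi>) x) (at x)"
proof -
  obtain R where R: "R > 0" "\<And>x. \<bar>x\<bar> > R \<Longrightarrow> \<psi> x = 0"
    using test_function_support[OF \<psi>] by blast
  obtain S where S: "S > 0" "\<And>x. \<bar>x\<bar> > S \<Longrightarrow> D \<psi> x = 0"
    using test_function_support[OF test_function_D[OF \<psi>]] by blast
  obtain C where C: "C > 0" "\<And>x. cmod (D (D \<psi>) x) \<le> C"
    using test_function_bounded[OF test_function_D[OF test_function_D[OF \<psi>]]] by blast
  define J where "J = {x - (R + S + 1)..x + (R + S + 1)}"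
  define K where "K = (LINT y|lebesgue. norm (indicator J y *\<^sub>R u y))"
  have int_J: "integrable lebesgue (\<lambda>y. indicator J y *\<^sub>R u y)"
    using u by (simp add: locally_integrable_def set_integrable_def J_def)
  have int: "integrable lebesgue (\<lambda>y. u y * \<psi> (y - t))"
    "integrable lebesgue (\<lambda>y. u y * D \<psi> (y - t))" for t
    by (intro integrable_mult_test_function u test_function_translate test_function_D \<psi>)+
  have remainder: "norm (pairing u \<psi> (x + h) - pairing u \<psi> x - h *\<^sub>R (- pairing u (D \<psi>) x))
      \<le> C * h\<^sup>2 * K" if h: "\<bar>h\<bar> < 1" for h
  proof -
    have expand: "u y * (\<psi> (y - x - h) - \<psi> (y - x) + h *\<^sub>R D \<psi> (y - x))
        = u y * \<psi> (y - (x + h)) - u y * \<psi> (y - x) + h *\<^sub>R (u y * D \<psi> (y - x))" for y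
      by (simp add: distrib_left right_diff_distrib diff_diff_eq)
    have "pairing u \<psi> (x + h) - pairing u \<psi> x - h *\<^sub>R (- pairing u (D \<psi>) x)
        = (LINT y|lebesgue. u y * (\<psi> (y - x - h) - \<psi> (y - x) + h *\<^sub>R D \<psi> (y - x)))"
      unfolding expand using int by (simp add: pairing_def regular_dist_def)
    also have "norm \<dots> \<le> (LINT y|lebesgue. C * h\<^sup>2 * norm (indicator J y *\<^sub>R u y))"
    proof (rule Bochner_Integration.integral_norm_bound_integral)
      show "integrable lebesgue (\<lambda>y. u y * (\<psi> (y - x - h) - \<psi> (y - x) + h *\<^sub>R D \<psi> (y - x)))"
        unfolding expand by (intro Bochner_Integration.integrable_add
            Bochner_Integration.integrable_diff integrable_scaleR_right int)
      show "integrable lebesgue (\<lambda>y. C * h\<^sup>2 * norm (indicator J y *\<^sub>R u y))"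
        using int_J by (intro integrable_mult_right integrable_norm)
      fix y
      show "norm (u y * (\<psi> (y - x - h) - \<psi> (y - x) + h *\<^sub>R D \<psi> (y - x)))
          \<le> C * h\<^sup>2 * norm (indicator J y *\<^sub>R u y)"
      proof (cases "y \<in> J")
        case True
        have "norm (u y) * norm (\<psi> (y - x - h) - \<psi> (y - x) + h *\<^sub>R D \<psi> (y - x))
            \<le> norm (u y) * (C * h\<^sup>2)"
          by (intro mult_left_mono smooth_second_order_remainder C test_function_smooth \<psi>) simp
        thus ?thesis using True by (simp add: norm_mult mult_ac)
      next
        case False
        hence "\<bar>y - x - h\<bar> > R" "\<bar>y - x\<bar> > R" "\<bar>y - x\<bar> > S"
          using h R(1) S(1) by (auto simp: J_def abs_if split: if_splits)
        thus ?thesis using R S False by simp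
      qed
    qed
    also have "\<dots> = C * h\<^sup>2 * K" by (simp add: K_def)
    finally show ?thesis .
  qed
  have "((\<lambda>h. norm (pairing u \<psi> (x + h) - pairing u \<psi> x - h *\<^sub>R (- pairing u (D \<psi>) x)) / norm h)
      \<longlongrightarrow> 0) (at 0)"
  proof (rule Lim_null_comparison)
    have "\<forall>\<^sub>F h in at (0::real). \<bar>h\<bar> < 1"
      unfolding eventually_at by (intro exI[of _ 1]) auto
    thus "\<forall>\<^sub>F h in at 0. norm (norm (pairing u \<psi> (x + h) - pairing u \<psi> x
        - h *\<^sub>R (- pairing u (D \<psi>) x)) / norm h) \<le> C * K * \<bar>h\<bar>"
    proof eventually_elim
      case (elim h)
      show ?case
      proof (cases "h = 0")
        case False
        with remainder[OF elim] show ?thesis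
          by (simp add: field_simps power2_eq_square flip: abs_mult)
      qed simp
    qed
    show "((\<lambda>h. C * K * \<bar>h\<bar>) \<longlongrightarrow> 0) (at 0)"
      by (auto intro!: tendsto_eq_intros)
  qed
  thus ?thesis
    unfolding has_vector_derivative_def has_derivative_at
    by (simp add: bounded_linear_minus bounded_linear_scaleR_left)
qed

text \<open>On the support of the translated test function, \<open>|y|\<close> exceeds \<open>|x|\<close> by at most \<open>R\<close>, so averaging
  keeps the exponential rate and costs only a constant factor.\<close>

lemma pairing_exp_bound:
  assumes "M \<ge> 0" "\<beta> \<ge> 0" "u \<in> borel_measurable lebesgue"
    "\<And>y. cmod (u y) \<le> M * exp (\<beta> * \<bar>y\<bar>)"
    and R: "R > 0" "\<And>x. \<bar>x\<bar> > R \<Longrightarrow> \<psi> x = 0" and C: "\<And>x. cmod (\<psi> x) \<le> C"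
    and \<psi>: "test_function \<psi>"
  shows "cmod (pairing u \<psi> x) \<le> M * exp (\<beta> * R) * C * (2 * R) * exp (\<beta> * \<bar>x\<bar>)"
proof -
  have u: "locally_integrable u"
    by (rule locally_integrable_bounded[OF assms(3) _ assms(4)]) (intro continuous_intros)
  let ?J = "{x - R..x + R}"
  let ?B = "M * exp (\<beta> * (R + \<bar>x\<bar>)) * C"
  have "cmod (pairing u \<psi> x) \<le> (LINT y|lebesgue. ?B * indicator ?J y)"
    unfolding pairing_def regular_dist_def
  proof (rule Bochner_Integration.integral_norm_bound_integral)
    show "integrable lebesgue (\<lambda>y. u y * \<psi> (y - x))"
      by (intro integrable_mult_test_function u test_function_translate \<psi>)
    show "integrable lebesgue (\<lambda>y. ?B * indicator ?J y)"
      by (intro integrable_mult_right integrable_real_indicator)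
         (auto simp: emeasure_lborel_Icc_eq)
    fix y
    show "norm (u y * \<psi> (y - x)) \<le> ?B * indicator ?J y"
    proof (cases "y \<in> ?J")
      case True
      hence "\<bar>y\<bar> \<le> R + \<bar>x\<bar>" by auto
      hence le: "M * exp (\<beta> * \<bar>y\<bar>) \<le> M * exp (\<beta> * (R + \<bar>x\<bar>))"
        using assms(1,2) by (intro mult_left_mono) (auto intro: mult_left_mono)
      have "cmod (u y) * cmod (\<psi> (y - x)) \<le> M * exp (\<beta> * (R + \<bar>x\<bar>)) * C"
        using assms(1) by (intro mult_mono C order_trans[OF assms(4) le]) auto
      thus ?thesis using True by (simp add: norm_mult)
    next
      case False
      hence "\<bar>y - x\<bar> > R" by auto
      thus ?thesis using R False by simp
    qed
  qed
  also have "\<dots> = ?B * (2 * R)" using R(1) by simp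
  finally show ?thesis by (simp only: distrib_left exp_add mult_ac)
qed

text \<open>The weak equation tested with a translate of \<open>\<psi>\<close> is the classical equation for the averages at the
  corresponding point.\<close>

lemma weak_ode_pairing_deriv:
  assumes "locally_integrable u" "weak_ode c u (\<lambda>x. A * v x)" "test_function \<psi>"
  shows "(pairing u \<psi> has_vector_derivative A * pairing v \<psi> x - c * pairing u \<psi> x) (at x)"
proof -
  have "- pairing u (D \<psi>) x + c * pairing u \<psi> x = A * pairing v \<psi> x"
    using assms(2)[unfolded weak_ode_def dist_eq_def, rule_format,
        OF test_function_translate[OF assms(3), of x]]
      fun_cong[OF D_translate[OF test_function_smooth[OF assms(3)], of x]]
    by (simp add: dist_deriv_def regular_dist_def pairing_def mult.assoc)
  hence "- pairing u (D \<psi>) x = A * pairing v \<psi> x - c * pairing u \<psi> x" by (simp add: algebra_simps)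
  thus ?thesis using pairing_deriv[OF assms(1,3), of x] by simp
qed

lemma admissible_locally_integrable:
  assumes "admissible lam A' A f"
  shows "locally_integrable (f k)"
proof -
  obtain M where "\<And>k x. cmod (f k x) \<le> M * exp (\<bar>Im lam\<bar> * \<bar>x\<bar>)"
    using assms by (auto simp: admissible_def exp_bounded_def)
  thus ?thesis using assms
    by (intro locally_integrable_bounded[where v = "\<lambda>x. M * exp (\<bar>Im lam\<bar> * \<bar>x\<bar>)"])
       (auto simp: admissible_def intro!: continuous_intros)
qed

lemma admissible_weak_ode:
  assumes "admissible lam \<alpha> A f" "Im lam \<noteq> 0"
  shows "weak_ode (- \<i> * lam + of_real (sgn (Im lam) * \<alpha>)) (f k) (\<lambda>x. A * f (k + 1) x)"
  using assms by (cases "Im lam > 0") (auto simp: admissible_def deriv_chain_def)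

text \<open>With \<open>\<sigma> = sgn (Im lam)\<close>, the factor \<open>exp (- c \<sigma> t)\<close> removes the zero-order term of the equation and has modulus
  \<open>exp (- (|Im lam| + \<alpha>) t)\<close>. On the half-line \<open>t \<ge> 0\<close> the first part absorbs the growth
  that is allowed for \<open>f\<close>, and the decay \<open>exp (- \<alpha> t)\<close> remains.\<close>

lemma admissible_half_line_chain:
  assumes adm: "admissible lam \<alpha> A f" and lam: "Im lam \<noteq> 0" and \<psi>: "test_function \<psi>"
  obtains w M where
    "\<And>n t. (w n has_vector_derivative - (of_real (sgn (Im lam)) * A) * w (Suc n) t) (at t)"
    "\<And>n t. t \<ge> 0 \<Longrightarrow> cmod (w n t) \<le> M * exp (- \<alpha> * t)"
    "\<And>n. w n 0 = regular_dist (f (k + int n)) \<psi>"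
proof -
  define \<sigma> where "\<sigma> = sgn (Im lam)"
  define c where "c = - \<i> * lam + of_real (\<sigma> * \<alpha>)"
  define w where "w n t = exp (- (c * of_real \<sigma>) * of_real t)
      * pairing (f (k + int n)) \<psi> (- \<sigma> * t)" for n t
  have \<sigma>: "\<sigma> * \<sigma> = 1" "\<sigma> * Im lam = \<bar>Im lam\<bar>" "\<bar>\<sigma>\<bar> = 1" using lam by (auto simp: \<sigma>_def sgn_if)
  let ?F = "\<lambda>n. pairing (f (k + int n)) \<psi>"
  have "((\<lambda>t. - \<sigma> * t) has_vector_derivative - \<sigma>) (at t)" for t
    by (auto intro!: derivative_eq_intros simp flip: has_real_derivative_iff_has_vector_derivative)
  moreover have "weak_ode c (f (k + int n)) (\<lambda>x. A * f (k + int (Suc n)) x)" for n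
    using admissible_weak_ode[OF adm lam, of "k + int n"] by (simp add: c_def \<sigma>_def add_ac)
  note weak_ode_pairing_deriv[OF admissible_locally_integrable[OF adm] this \<psi>]
  ultimately
  have F_deriv: "((\<lambda>t. ?F n (- \<sigma> * t)) has_vector_derivative
      - \<sigma> *\<^sub>R (A * ?F (Suc n) (- \<sigma> * t) - c * ?F n (- \<sigma> * t))) (at t)" for n t
    using vector_diff_chain_at by (fastforce simp: o_def)
  have w_deriv: "(w n has_vector_derivative - (of_real \<sigma> * A) * w (Suc n) t) (at t)" for n t
    using has_vector_derivative_mult[OF exp_linear_deriv[of "- (c * of_real \<sigma>)" t] F_deriv[of n t]]
    unfolding w_def[abs_def] by (simp add: scaleR_conv_of_real algebra_simps)
  obtain M where M: "M > 0" "\<And>k x. cmod (f k x) \<le> M * exp (\<bar>Im lam\<bar> * \<bar>x\<bar>)"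
    using adm by (auto simp: admissible_def exp_bounded_def)
  obtain R where R: "R > 0" "\<And>x. \<bar>x\<bar> > R \<Longrightarrow> \<psi> x = 0"
    using test_function_support[OF \<psi>] by blast
  obtain C where C: "C > 0" "\<And>x. cmod (\<psi> x) \<le> C"
    using test_function_bounded[OF \<psi>] by blast
  define K where "K = M * exp (\<bar>Im lam\<bar> * R) * C * (2 * R)"
  have "cmod (w n t) \<le> K * exp (- \<alpha> * t)" if "t \<ge> 0" for n t
  proof -
    have "cmod (?F n (- \<sigma> * t)) \<le> K * exp (\<bar>Im lam\<bar> * \<bar>- \<sigma> * t\<bar>)"
      unfolding K_def using M R C adm
      by (intro pairing_exp_bound \<psi>) (auto simp: admissible_def)
    also have "\<bar>- \<sigma> * t\<bar> = t" using that \<sigma>(3) by (simp add: abs_mult)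
    finally have F: "cmod (?F n (- \<sigma> * t)) \<le> K * exp (\<bar>Im lam\<bar> * t)" .
    have "Re (- (c * of_real \<sigma>) * of_real t) = - (\<sigma> * Im lam + \<sigma> * \<sigma> * \<alpha>) * t"
      by (simp add: c_def algebra_simps)
    hence "cmod (exp (- (c * of_real \<sigma>) * of_real t)) = exp (- (\<bar>Im lam\<bar> + \<alpha>) * t)"
      unfolding norm_exp_eq_Re \<sigma> by simp
    hence "cmod (w n t) = exp (- (\<bar>Im lam\<bar> + \<alpha>) * t) * cmod (?F n (- \<sigma> * t))"
      unfolding w_def norm_mult by simp
    also have "\<dots> \<le> exp (- (\<bar>Im lam\<bar> + \<alpha>) * t) * (K * exp (\<bar>Im lam\<bar> * t))"
      by (intro mult_left_mono F) simp
    also have "\<dots> = K * exp (- (\<bar>Im lam\<bar> + \<alpha>) * t + \<bar>Im lam\<bar> * t)"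
      by (simp only: exp_add mult_ac)
    also have "- (\<bar>Im lam\<bar> + \<alpha>) * t + \<bar>Im lam\<bar> * t = - \<alpha> * t" by (simp add: algebra_simps)
    finally show ?thesis .
  qed
  with w_deriv show thesis
    by (intro that[of w K]) (simp_all add: w_def pairing_def \<sigma>_def)
qed

section \<open>Weak and classical equations\<close>

text \<open>The antiderivative is constant to the left and to the right of the support of \<open>\<psi>\<close>, and the two constants
  agree because the integral vanishes.\<close>

lemma test_function_antiderivative:
  assumes \<psi>: "test_function \<psi>" and zero: "(LINT x|lebesgue. \<psi> x) = 0"
  obtains \<phi> where "test_function \<phi>" "D \<phi> = \<psi>"
proof -
  have cont: "continuous_on UNIV \<psi>" by (intro smooth_continuous test_function_smooth \<psi>)
  hence "isCont \<psi> x" for x by (simp add: continuous_on_eq_continuous_at)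
  with einterval_antiderivative[of "-\<infinity>" "\<infinity>" \<psi>] obtain F where
    F: "\<And>x. (F has_vector_derivative \<psi> x) (at x)" by auto
  obtain R where R: "R > 0" "\<And>x. \<bar>x\<bar> > R \<Longrightarrow> \<psi> x = 0"
    using test_function_support[OF \<psi>] by blast
  define \<phi> where "\<phi> x = F x - F R" for x
  have \<phi>: "(\<phi> has_vector_derivative \<psi> x) (at x)" for x
    unfolding \<phi>_def[abs_def] using has_vector_derivative_diff[OF F has_vector_derivative_const] by simp
  have right: "F x = F R" if "x \<ge> R" for x
    using norm_diff_le_majorant[OF that F has_vector_derivative_const[of 0]] R by simp
  have left: "F x = F (-R)" if "x \<le> -R" for x
    using norm_diff_le_majorant[OF that F has_vector_derivative_const[of 0]] R by simp
  have "F R = F (-R)"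
    using integral_deriv_compact_support[OF R(1) F cont R(2)] zero by simp
  hence "\<phi> x = 0" if "\<bar>x\<bar> > R" for x
    using that left[of x] right[of x] by (cases "x \<ge> 0") (simp_all add: \<phi>_def)
  moreover have "smooth \<phi>"
  proof (rule smooth_coinduct[of "\<lambda>f. f = \<phi> \<or> smooth f"])
    fix f assume "f = \<phi> \<or> smooth f"
    thus "\<exists>f'. (\<forall>x. (f has_vector_derivative f' x) (at x)) \<and> (f' = \<phi> \<or> smooth f')"
    proof
      assume "f = \<phi>"
      with \<phi> test_function_smooth[OF \<psi>] show ?thesis by (intro exI[of _ \<psi>]) simp
    next
      assume "smooth f"
      thus ?thesis by (intro exI[of _ "D f"]) (simp add: smooth_deriv smooth_D)
    qed
  qed simp
  ultimately have "test_function \<phi>" using R(1) unfolding test_function_iff by blast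
  moreover have "D \<phi> = \<psi>" using \<phi> by (intro ext vector_derivative_at)
  ultimately show thesis by (rule that)
qed

text \<open>Fix a test function \<open>\<theta>\<close> whose integral is not zero. Every test function \<open>\<psi>\<close> differs
  from a multiple of \<open>\<theta>\<close> by one with integral zero, that is, by a derivative of a test function. Hence
  \<open>\<integral> u \<psi>\<close> is a constant multiple of \<open>\<integral> \<psi>\<close>.\<close>

lemma weak_deriv_zero_imp_AE_const:
  assumes u: "locally_integrable u"
    and weak: "\<And>\<phi>. test_function \<phi> \<Longrightarrow> (LINT x|lebesgue. u x * D \<phi> x) = 0"
  shows "\<exists>c. AE x in lebesgue. u x = c"
proof -
  have one: "locally_integrable (\<lambda>_. c)" for c
    by (intro locally_integrable_continuous continuous_intros)
  have int1: "integrable lebesgue \<phi>" if "test_function \<phi>" for \<phi>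
    using integrable_mult_test_function[OF one[of 1] that] by simp
  \<comment> \<open>If all test functions had integral zero, the constant 1 would vanish almost everywhere.\<close>
  obtain \<theta> where \<theta>: "test_function \<theta>" "(LINT x|lebesgue. \<theta> x) \<noteq> 0"
  proof (rule ccontr)
    assume "\<not> thesis"
    with that have "(LINT x|lebesgue. \<phi> x) = 0" if "test_function \<phi>" for \<phi> using \<open>test_function \<phi>\<close> by blast
    hence "AE x in (lebesgue :: real measure). (1::complex) = 0"
      by (intro AE_eq_0_if_orthogonal_to_test_functions one) simp
    then obtain N :: "real set" where "negligible N" "UNIV \<subseteq> N"
      unfolding eventually_ae_filter_negligible by auto
    hence "negligible (UNIV :: real set)" by (rule negligible_subset)
    thus False by simp
  qed
  define c where "c = (LINT x|lebesgue. u x * \<theta> x) / (LINT x|lebesgue. \<theta> x)"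
  have "AE x in lebesgue. u x - c = 0"
  proof (rule AE_eq_0_if_orthogonal_to_test_functions)
    show "locally_integrable (\<lambda>x. u x - c)" by (intro locally_integrable_diff u one)
    fix \<psi> assume \<psi>: "test_function \<psi>"
    define a where "a = (LINT x|lebesgue. \<psi> x) / (LINT x|lebesgue. \<theta> x)"
    have test: "test_function (\<lambda>x. \<psi> x + (- a) * \<theta> x)"
      by (intro test_function_add \<psi> test_function_mult_smooth \<theta> smooth_const)
    have "(LINT x|lebesgue. \<psi> x + (- a) * \<theta> x) = 0"
      using int1[OF \<psi>] int1[OF \<theta>(1)] \<theta>(2) by (simp add: a_def)
    from test_function_antiderivative[OF test this] obtain \<phi> where
      \<phi>: "test_function \<phi>" "D \<phi> = (\<lambda>x. \<psi> x + (- a) * \<theta> x)" by blast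
    have int: "integrable lebesgue (\<lambda>x. u x * \<psi> x)" "integrable lebesgue (\<lambda>x. u x * \<theta> x)"
      by (intro integrable_mult_test_function u \<psi> \<theta>)+
    have "0 = (LINT x|lebesgue. u x * D \<phi> x)" using weak[OF \<phi>(1)] by simp
    also have "\<dots> = (LINT x|lebesgue. u x * \<psi> x - a * (u x * \<theta> x))"
      unfolding fun_cong[OF \<phi>(2)] by (simp add: algebra_simps)
    also have "\<dots> = (LINT x|lebesgue. u x * \<psi> x) - a * (LINT x|lebesgue. u x * \<theta> x)"
      using int by simp
    also have "\<dots> = (LINT x|lebesgue. u x * \<psi> x) - c * (LINT x|lebesgue. \<psi> x)"
      by (simp add: a_def c_def)
    also have "\<dots> = (LINT x|lebesgue. u x * \<psi> x - c * \<psi> x)"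
      using int int1[OF \<psi>] by simp
    finally show "(LINT x|lebesgue. (u x - c) * \<psi> x) = 0" by (simp add: left_diff_distrib)
  qed
  thus ?thesis by auto
qed

lemma D_mult_exp:
  assumes "smooth \<phi>"
  shows "D (\<lambda>x. exp (\<nu> * of_real x) * \<phi> x)
    = (\<lambda>x. exp (\<nu> * of_real x) * D \<phi> x + \<nu> * (exp (\<nu> * of_real x) * \<phi> x))"
proof
  fix x
  show "D (\<lambda>x. exp (\<nu> * of_real x) * \<phi> x) x
      = exp (\<nu> * of_real x) * D \<phi> x + \<nu> * (exp (\<nu> * of_real x) * \<phi> x)"
    using has_vector_derivative_mult[OF exp_linear_deriv[of \<nu> x] smooth_deriv[OF assms]]
    by (intro vector_derivative_at) (simp add: mult.assoc)
qed

text \<open>Testing the eigenvalue equation with \<open>exp (- \<mu> x) \<phi>\<close> shows that \<open>exp (- \<mu> x) u\<close> is weakly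
  constant.\<close>

lemma deriv_eq_mult_imp_exponential:
  assumes u: "locally_integrable u" and eig: "deriv_eq_mult u \<mu>"
  shows "\<exists>c. AE x in lebesgue. u x = c * exp (\<mu> * of_real x)"
proof -
  let ?e = "\<lambda>x::real. exp (- \<mu> * of_real x)"
  have "\<exists>c. AE x in lebesgue. ?e x * u x = c"
  proof (rule weak_deriv_zero_imp_AE_const)
    show "locally_integrable (\<lambda>x. ?e x * u x)"
      by (intro locally_integrable_mult_continuous u smooth_continuous smooth_exp)
    fix \<phi> assume \<phi>: "test_function \<phi>"
    let ?\<eta> = "\<lambda>x. ?e x * \<phi> x"
    have \<eta>: "test_function ?\<eta>" by (intro test_function_mult_smooth \<phi> smooth_exp)
    have int: "integrable lebesgue (\<lambda>x. u x * D ?\<eta> x)" "integrable lebesgue (\<lambda>x. u x * ?\<eta> x)"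
      by (intro integrable_mult_test_function u \<eta> test_function_D)+
    have "?e x * u x * D \<phi> x = u x * D ?\<eta> x + \<mu> * (u x * ?\<eta> x)" for x
      by (simp only: fun_cong[OF D_mult_exp[OF test_function_smooth[OF \<phi>]]]) (simp add: algebra_simps)
    hence "(LINT x|lebesgue. ?e x * u x * D \<phi> x)
        = (LINT x|lebesgue. u x * D ?\<eta> x + \<mu> * (u x * ?\<eta> x))" by (simp only:)
    also have "\<dots> = (LINT x|lebesgue. u x * D ?\<eta> x) + \<mu> * (LINT x|lebesgue. u x * ?\<eta> x)"
      using int by simp
    also have "\<mu> * (LINT x|lebesgue. u x * ?\<eta> x) = - (LINT x|lebesgue. u x * D ?\<eta> x)"
      using eig[unfolded deriv_eq_mult_def dist_eq_def, rule_format, OF \<eta>]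
      by (simp add: dist_deriv_def regular_dist_def mult.assoc)
    finally show "(LINT x|lebesgue. ?e x * u x * D \<phi> x) = 0" by simp
  qed
  then obtain c where "AE x in lebesgue. ?e x * u x = c" by blast
  hence "AE x in lebesgue. u x = c * exp (\<mu> * of_real x)"
    by eventually_elim (simp add: exp_minus field_simps)
  thus ?thesis by blast
qed

lemma continuous_AE_eq_0:
  fixes u :: "real \<Rightarrow> complex"
  assumes "continuous_on UNIV u" "AE x in lebesgue. u x = 0"
  shows "u x = 0"
proof -
  have "open {x. u x \<noteq> 0}" using assms(1) by (intro open_Collect_neq continuous_intros)
  moreover have "negligible {x. u x \<noteq> 0}"
    using assms(2) unfolding eventually_ae_filter_negligible by (auto intro: negligible_subset)
  ultimately have "{x. u x \<noteq> 0} = {}" using open_not_negligible by blast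
  thus ?thesis by blast
qed

lemma weak_ode_if_classical:
  assumes "\<And>x. (F has_vector_derivative G x - c * F x) (at x)" "continuous_on UNIV G"
  shows "weak_ode c F G"
  unfolding weak_ode_def dist_eq_def
proof (intro allI impI)
  fix \<phi> assume \<phi>: "test_function \<phi>"
  have F: "continuous_on UNIV F"
    using assms(1) by (meson continuous_at_imp_continuous_on has_vector_derivative_continuous)
  have int: "integrable lebesgue (\<lambda>x. G x * \<phi> x)" "integrable lebesgue (\<lambda>x. F x * \<phi> x)"
    by (intro integrable_mult_test_function locally_integrable_continuous F assms \<phi>)+
  have "(LINT x|lebesgue. F x * D \<phi> x) = - (LINT x|lebesgue. (G x - c * F x) * \<phi> x)"
    by (intro integral_by_parts_test_function assms(1) \<phi> continuous_intros F assms(2))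
  also have "(LINT x|lebesgue. (G x - c * F x) * \<phi> x)
      = (LINT x|lebesgue. G x * \<phi> x) - c * (LINT x|lebesgue. F x * \<phi> x)"
    using int by (simp add: left_diff_distrib mult.assoc)
  finally show "dist_deriv (regular_dist F) \<phi> + c * regular_dist F \<phi> = regular_dist G \<phi>"
    by (simp add: dist_deriv_def regular_dist_def)
qed

lemma deriv_eq_mult_imp_classical:
  assumes "\<And>x. (F has_vector_derivative F' x) (at x)" "continuous_on UNIV F'" "deriv_eq_mult F \<mu>"
  shows "F' x = \<mu> * F x"
proof -
  have F: "continuous_on UNIV F"
    using assms(1) by (meson continuous_at_imp_continuous_on has_vector_derivative_continuous)
  have "F' x - \<mu> * F x = 0"
  proof (rule continuous_AE_eq_0)
    show "continuous_on UNIV (\<lambda>x. F' x - \<mu> * F x)" by (intro continuous_intros F assms)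
    hence "locally_integrable (\<lambda>x. F' x - \<mu> * F x)" by (rule locally_integrable_continuous)
    thus "AE x in lebesgue. F' x - \<mu> * F x = 0"
    proof (rule AE_eq_0_if_orthogonal_to_test_functions)
      fix \<phi> assume \<phi>: "test_function \<phi>"
      have int: "integrable lebesgue (\<lambda>x. F' x * \<phi> x)" "integrable lebesgue (\<lambda>x. F x * \<phi> x)"
        by (intro integrable_mult_test_function locally_integrable_continuous F assms \<phi>)+
      have "(LINT x|lebesgue. F' x * \<phi> x) = - (LINT x|lebesgue. F x * D \<phi> x)"
        using integral_by_parts_test_function[OF assms(1,2) \<phi>] by simp
      also have "\<dots> = \<mu> * (LINT x|lebesgue. F x * \<phi> x)"
        using assms(3)[unfolded deriv_eq_mult_def dist_eq_def, rule_format, OF \<phi>]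
        by (simp add: dist_deriv_def regular_dist_def mult.assoc)
      finally show "(LINT x|lebesgue. (F' x - \<mu> * F x) * \<phi> x) = 0"
        using int by (simp add: left_diff_distrib mult.assoc)
    qed
  qed
  thus ?thesis by simp
qed

section \<open>The three regimes\<close>

lemma subcritical_admissible_zero:
  assumes adm: "admissible lam \<alpha> A f" and "Im lam \<noteq> 0" "\<alpha> > 0" "cmod A < \<alpha>"
  shows "AE x in lebesgue. f k x = 0"
proof (rule AE_eq_0_if_orthogonal_to_test_functions)
  show "locally_integrable (f k)" by (rule admissible_locally_integrable[OF adm])
  fix \<psi> assume \<psi>: "test_function \<psi>"
  obtain w M where chain:
    "\<And>n t. (w n has_vector_derivative - (of_real (sgn (Im lam)) * A) * w (Suc n) t) (at t)"
    "\<And>n t. t \<ge> 0 \<Longrightarrow> cmod (w n t) \<le> M * exp (- \<alpha> * t)"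
    "\<And>n. w n 0 = regular_dist (f (k + int n)) \<psi>"
    using admissible_half_line_chain[OF adm assms(2) \<psi>, where k = k] by blast
  have "cmod (of_real (sgn (Im lam)) * A) < \<alpha>"
    using assms by (simp add: norm_mult abs_sgn_eq)
  from subcritical_chain_zero[where w = w, OF assms(3) this chain(1,2)] chain(3)[of 0]
  show "(LINT x|lebesgue. f k x * \<psi> x) = 0"
    by (simp add: regular_dist_def)
qed

text \<open>For the averages, \<open>critical_chain_eigen\<close> says \<open>\<sigma> A F\<^sub>k\<^sub>+\<^sub>1(0) = \<alpha> F\<^sub>k(0)\<close>. As \<open>\<psi>\<close> is
  arbitrary, \<open>A f\<^sub>k\<^sub>+\<^sub>1 = \<sigma> \<alpha> f\<^sub>k\<close> as distributions, and these two terms cancel in the chain.\<close>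

lemma critical_admissible_eigen:
  assumes adm: "admissible lam \<alpha> A f" and lam: "Im lam \<noteq> 0" and "\<alpha> > 0" "cmod A = \<alpha>"
  shows "deriv_eq_mult (f k) (\<i> * lam)"
  unfolding deriv_eq_mult_def dist_eq_def
proof (intro allI impI)
  fix \<psi> assume \<psi>: "test_function \<psi>"
  define \<sigma> where "\<sigma> = sgn (Im lam)"
  have \<sigma>: "of_real \<sigma> * (of_real \<sigma> :: complex) = 1" "\<bar>\<sigma>\<bar> = 1"
    using lam by (auto simp: \<sigma>_def sgn_if)
  obtain w M where chain:
    "\<And>n t. (w n has_vector_derivative - (of_real \<sigma> * A) * w (Suc n) t) (at t)"
    "\<And>n t. t \<ge> 0 \<Longrightarrow> cmod (w n t) \<le> M * exp (- \<alpha> * t)"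
    "\<And>n. w n 0 = regular_dist (f (k + int n)) \<psi>"
    using admissible_half_line_chain[OF adm assms(2) \<psi>, where k = k] unfolding \<sigma>_def by blast
  have "cmod (of_real \<sigma> * A) = \<alpha>"
    using assms \<sigma> by (simp add: norm_mult)
  from critical_chain_eigen[where w = w, OF assms(3) this chain(1,2)] chain(3)[of 0] chain(3)[of 1]
  have "\<sigma> * A * regular_dist (f (k + 1)) \<psi> = \<alpha> * regular_dist (f k) \<psi>" by simp
  hence "\<sigma> * (\<sigma> * A * regular_dist (f (k + 1)) \<psi>) = \<sigma> * (\<alpha> * regular_dist (f k) \<psi>)" by simp
  hence eq: "A * regular_dist (f (k + 1)) \<psi> = of_real (\<sigma> * \<alpha>) * regular_dist (f k) \<psi>"
    using \<sigma>(1) by (simp add: mult.assoc[symmetric])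
  have "dist_deriv (regular_dist (f k)) \<psi> + (- \<i> * lam + of_real (\<sigma> * \<alpha>)) * regular_dist (f k) \<psi>
      = A * regular_dist (f (k + 1)) \<psi>"
    using admissible_weak_ode[OF adm lam, of k] \<psi>
    by (simp add: weak_ode_def dist_eq_def regular_dist_def \<sigma>_def mult.assoc)
  with eq have "dist_deriv (regular_dist (f k)) \<psi> = \<i> * lam * regular_dist (f k) \<psi>"
    by (simp add: algebra_simps)
  thus "dist_deriv (regular_dist (f k)) \<psi> = regular_dist (\<lambda>x. \<i> * lam * f k x) \<psi>"
    by (simp add: regular_dist_def mult.assoc)
qed

text \<open>The exponents \<open>p\<close> and \<open>q\<close> are \<open>\<i> (lam \<plusminus> s)\<close>. For real \<open>s\<close> both exponentials have
  the modulus of \<open>exp (\<i> lam x)\<close>, and \<open>|p + c|\<^sup>2 = |q + c|\<^sup>2 = \<alpha>\<^sup>2 + s\<^sup>2\<close>, which equals \<open>|A|\<^sup>2\<close> for the chosen \<open>s\<close>.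
  Each exponential then generates a chain whose coefficients \<open>((p + c) / A)^k\<close> have modulus 1, for
  negative \<open>k\<close> as well.\<close>

lemma supercritical_admissible_noneigen:
  assumes lam: "Im lam \<noteq> 0" and \<alpha>: "\<alpha> > 0" "cmod A > \<alpha>"
  shows "\<exists>f. admissible lam \<alpha> A f \<and> \<not> (\<exists>\<mu>. deriv_eq_mult (f 0) \<mu>)"
proof -
  define \<sigma> where "\<sigma> = sgn (Im lam)"
  define s where "s = sqrt ((cmod A)\<^sup>2 - \<alpha>\<^sup>2)"
  define c where "c = - \<i> * lam + of_real (\<sigma> * \<alpha>)"
  define p where "p = \<i> * (lam + of_real s)"
  define q where "q = \<i> * (lam - of_real s)"
  define f where "f k x = exp (p * of_real x) * ((p + c) / A) powi k
      + exp (q * of_real x) * ((q + c) / A) powi k" for k :: int and x :: real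
  have A: "A \<noteq> 0" using \<alpha> by auto
  have "\<alpha>\<^sup>2 < (cmod A)\<^sup>2" using \<alpha> by (intro power_strict_mono) auto
  hence s: "s > 0" "s\<^sup>2 = (cmod A)\<^sup>2 - \<alpha>\<^sup>2" by (auto simp: s_def)
  have \<sigma>: "\<sigma>\<^sup>2 = 1" using lam by (auto simp: \<sigma>_def sgn_if)
  have unit: "cmod ((p + c) / A) = 1" "cmod ((q + c) / A) = 1"
  proof -
    have "p + c = Complex (\<sigma> * \<alpha>) s" "q + c = Complex (\<sigma> * \<alpha>) (- s)"
      by (auto simp: p_def q_def c_def complex_eq_iff)
    hence "cmod (p + c) = cmod A" "cmod (q + c) = cmod A"
      using s \<sigma> by (auto simp: cmod_def power_mult_distrib)
    thus "cmod ((p + c) / A) = 1" "cmod ((q + c) / A) = 1" using A by (auto simp: norm_divide)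
  qed
  hence nz: "p + c \<noteq> 0" "q + c \<noteq> 0" by auto
  have f_cont: "continuous_on UNIV (f k)" for k
    unfolding f_def[abs_def] by (intro continuous_intros)
  have f_step: "A * f (k + 1) x = (p + c) * (exp (p * of_real x) * ((p + c) / A) powi k)
      + (q + c) * (exp (q * of_real x) * ((q + c) / A) powi k)" for k x
  proof -
    have shift: "A * (e * z powi (k + 1)) = (A * z) * (e * z powi k)" if "z \<noteq> 0" for e z
      using that by (simp add: power_int_add_1)
    have "(p + c) / A \<noteq> 0" "(q + c) / A \<noteq> 0" using A nz by auto
    from this[THEN shift] show ?thesis
      unfolding f_def distrib_left using A by (simp only:) simp
  qed
  have f_deriv: "(f k has_vector_derivative
      p * exp (p * of_real x) * ((p + c) / A) powi k + q * exp (q * of_real x) * ((q + c) / A) powi k)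
      (at x)" for k x
    unfolding f_def[abs_def]
    by (intro has_vector_derivative_add has_vector_derivative_mult_left exp_linear_deriv)
  have ode: "weak_ode c (f k) (\<lambda>x. A * f (k + 1) x)" for k
  proof (rule weak_ode_if_classical)
    show "(f k has_vector_derivative A * f (k + 1) x - c * f k x) (at x)" for x
      using f_deriv[of k x] unfolding f_step by (simp add: f_def algebra_simps)
    show "continuous_on UNIV (\<lambda>x. A * f (k + 1) x)" by (intro continuous_intros f_cont)
  qed
  have "admissible lam \<alpha> A f"
    unfolding admissible_def
  proof (intro conjI allI)
    show "f k \<in> borel_measurable lebesgue" for k
      by (rule continuous_borel_measurable_lebesgue[OF f_cont])
    show "deriv_chain lam \<alpha> A f"
    proof (cases "Im lam > 0")
      case True
      hence "c = - \<i> * lam + of_real \<alpha>" by (simp add: c_def \<sigma>_def)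
      with ode True show ?thesis by (simp add: deriv_chain_def)
    next
      case False
      with lam have "c = - \<i> * lam - of_real \<alpha>" by (simp add: c_def \<sigma>_def)
      with ode False show ?thesis by (simp add: deriv_chain_def)
    qed
    have "cmod (f k x) \<le> 2 * exp (\<bar>Im lam\<bar> * \<bar>x\<bar>)" for k x
    proof -
      have "- (Im lam * x) \<le> \<bar>Im lam\<bar> * \<bar>x\<bar>" using abs_ge_minus_self[of "Im lam * x"] by (simp add: abs_mult)
      hence "exp (- (Im lam * x)) \<le> exp (\<bar>Im lam\<bar> * \<bar>x\<bar>)" by simp
      moreover have "cmod (f k x) \<le> exp (- (Im lam * x)) + exp (- (Im lam * x))"
        unfolding f_def
        by (rule order_trans[OF norm_triangle_ineq])
           (simp add: norm_mult norm_power_int unit, simp add: p_def q_def)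
      ultimately show ?thesis by linarith
    qed
    thus "exp_bounded lam f" unfolding exp_bounded_def by (intro exI[of _ 2]) auto
  qed
  moreover have False if eig: "deriv_eq_mult (f 0) \<mu>" for \<mu>
  proof -
    have "continuous_on UNIV (\<lambda>x. p * exp (p * of_real x) * ((p + c) / A) powi 0
        + q * exp (q * of_real x) * ((q + c) / A) powi 0)"
      by (intro continuous_intros)
    note deriv_eq_mult_imp_classical[OF f_deriv this eig]
    hence eq: "p * exp (p * of_real x) + q * exp (q * of_real x)
        = \<mu> * (exp (p * of_real x) + exp (q * of_real x))" for x
      by (simp add: f_def)
    \<comment> \<open>At this point the two exponentials are opposite, so \<open>f 0\<close> vanishes there while its derivative does
      not.\<close>
    define x where "x = pi / (2 * s)"
    have "p * of_real x = \<i> * of_real pi + q * of_real x"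
      using s(1) by (simp add: p_def q_def x_def field_simps)
    hence "exp (p * of_real x) = exp (\<i> * of_real pi) * exp (q * of_real x)"
      by (simp only: exp_add)
    hence "exp (p * of_real x) = - exp (q * of_real x)" by simp
    with eq[of x] have "p = q" by simp
    thus False using s(1) by (simp add: p_def q_def)
  qed
  ultimately show ?thesis by blast
qed

theorem theorem1p6:
  fixes lam\<^sub>0 A :: complex and \<alpha> :: real
  assumes "Im lam\<^sub>0 \<noteq> 0" and "\<alpha> > 0" and "A \<noteq> 0"
  shows
    "(cmod A = \<bar>\<alpha>\<bar> \<longrightarrow>
        (\<forall>f. admissible lam\<^sub>0 \<alpha> A f \<longrightarrow>
           deriv_eq_mult (f 0) (\<i> * lam\<^sub>0) \<and>
           (\<exists>c. AE x in lebesgue. f 0 x = c * exp (\<i> * lam\<^sub>0 * of_real x)))) \<and>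
     (cmod A < \<bar>\<alpha>\<bar> \<longrightarrow>
        (\<forall>f. admissible lam\<^sub>0 \<alpha> A f \<longrightarrow> (\<forall>k. AE x in lebesgue. f k x = 0))) \<and>
     (cmod A > \<bar>\<alpha>\<bar> \<longrightarrow>
        (\<exists>f. admissible lam\<^sub>0 \<alpha> A f \<and> \<not> (\<exists>\<mu>. deriv_eq_mult (f 0) \<mu>)))"
proof (intro conjI impI allI)
  fix f assume "cmod A = \<bar>\<alpha>\<bar>" and adm: "admissible lam\<^sub>0 \<alpha> A f"
  with assms show eig: "deriv_eq_mult (f 0) (\<i> * lam\<^sub>0)"
    by (intro critical_admissible_eigen[OF adm]) auto
  show "\<exists>c. AE x in lebesgue. f 0 x = c * exp (\<i> * lam\<^sub>0 * of_real x)"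
    by (rule deriv_eq_mult_imp_exponential[OF admissible_locally_integrable[OF adm] eig])
next
  fix f k assume "cmod A < \<bar>\<alpha>\<bar>" and adm: "admissible lam\<^sub>0 \<alpha> A f"
  with assms show "AE x in lebesgue. f k x = 0"
    by (intro subcritical_admissible_zero[OF adm]) auto
next
  assume "cmod A > \<bar>\<alpha>\<bar>"
  with assms show "\<exists>f. admissible lam\<^sub>0 \<alpha> A f \<and> \<not> (\<exists>\<mu>. deriv_eq_mult (f 0) \<mu>)"
    by (intro supercritical_admissible_noneigen) auto
qed

end
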